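(* Let $x\in\mathbb{R}$ be fixed, let $f$ and $k$ be probability densities on $\mathbb{R}$ with characteristic functions $\phi_f$ and $\phi_k$, let $w$ be a kernel with Fourier transform $\phi_w$, and let $(h_n)$ and $(\sigma_n)$ be sequences of positive numbers. Assume that: (i) $\phi_f$ is integrable; (ii) $\phi_k(t)\ne 0$ for all $t\in\mathbb{R}$ and $\phi_k(t)\sim C|t|^{\lambda_0}\exp(-|t|^{\lambda}/\mu)$ as $|t|\to\infty$, for some constants $\lambda>1$, $\mu>0$ and real constants $\lambda_0$ and $C$; (iii) $w$ is a bounded, symmetric and continuous function; $\phi_w$ is supported on $[-1,1]$, $\phi_w(0)=1$ and $|\phi_w(t)|\le 1$ for all $t$; moreover $\phi_w(1-t)=At^{\alpha}+o(t^{\alpha})$ as $t\downarrow 0$, where $A\in\mathbb{R}$ and $\alpha\ge 0$ are some numbers; (iv) $h_n\to 0$ and $nh_n\to\infty$ as $n\to\infty$; (v) $\sigma_n\to 0$ and $\sigma_n^{\lambda}/h_n^{\lambda-1}\to\infty$ as $n\to\infty$. Let $f_{nh_n}(x)$ be the deconvolution kernel density estimator based on $X_1,\ldots,X_n$, where $X_j=Y_j+\sigma_nZ_j$, and assume furthermore that $\mathrm{E}[Y_j^2]<\infty$ and $\mathrm{E}[Z_j^2]<\infty$. Put $\rho_n=h_n/\sigma_n$ and $\zeta(\rho_n)=\exp\bigl(1/(\mu\rho_n^{\lambda})\bigr)$. Then $$\frac{\sqrt{n}\,\sigma_n}{\rho_n^{\lambda(1+\alpha)+\lambda_0-1}\,\zeta(\rho_n)}\,\bigl(f_{nh_n}(x)-\mathrm{E}[f_{nh_n}(x)]\bigr)\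 \xrightarrow{\ \mathcal{D}\ }\ \mathcal{N}\left(0,\ \frac{A^2}{2\pi^2C^2}\left(\frac{\mu}{\lambda}\right)^{2+2\alpha}(\Gamma(\alpha+1))^2\right)$$ as $n\to\infty$.
   Context: Model: for each $n$, one observes i.i.d. random variables $X_1,\ldots,X_n$ with $X_j=Y_j+\sigma_n Z_j$, where the $Y_j$ are i.i.d. with density $f$, the $Z_j$ are i.i.d. with known density $k$, and the $Y$'s and $Z$'s are independent. Here $\sigma_n$ depends on $n$. Conventions: $\phi_f(t)=\int e^{ity}f(y)\,dy$, $\phi_k(t)=\int e^{itz}k(z)\,dz$. The kernel $w$ is a real function on $\mathbb{R}$ (not necessarily nonnegative), with Fourier transform $\phi_w$, i.e. $w(x)=\frac{1}{2\pi}\int_{-\infty}^\infty e^{-itx}\phi_w(t)\,dt$. The relation $a(t)\sim b(t)$ means $a(t)/b(t)\to 1$ (so $C\neq0$). The empirical characteristic function is $\phi_{emp}(t)=n^{-1}\sum_{j=1}^n e^{itX_j}$. The deconvolution kernel density estimator is $$f_{nh_n}(x)=\frac{1}{2\pi}\int_{-\infty}^{\infty}e^{-itx}\,\frac{\phi_w(h_nt)\,\phi_{emp}(t)}{\phi_k(\sigma_n t)}\,dt=\frac1n\sum_{j=1}^n\frac1{h_n}w_{\rho_n}\left(\frac{x-X_j}{h_n}\right),$$ where $w_{\rho_n}(u)=\frac{1}{2\pi}\int_{-\infty}^{\infty}e^{-itu}\frac{\phi_w(t)}{\phi_k(t/\rho_n)}\,dt$ and $\rho_n=h_n/\sigma_n$.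 $\Gamma$ is the Gamma function; $\xrightarrow{\mathcal D}$ denotes convergence in distribution; $\mathcal N(m,v)$ is the normal distribution with mean $m$ and variance $v$ (a point mass at $m$ if $v=0$). *)

theory Defs
  imports "HOL-Probability.Probability"
begin

definition prob_density :: "(real \<Rightarrow> real) \<Rightarrow> bool" where
  "prob_density f \<longleftrightarrow>
     f \<in> borel_measurable borel \<and> (\<forall>x. 0 \<le> f x) \<and> prob_space (density lborel (\<lambda>x. ennreal (f x)))"

definition dens_cf :: "(real \<Rightarrow> real) \<Rightarrow> real \<Rightarrow> complex" where
  "dens_cf f t = (CLINT y|lborel. iexp (t * y) * complex_of_real (f y))"

text \<open>The Fourier transform of the kernel is tied to the kernel by the inversion formula, because
  \<open>w\<close> need not be Lebesgue integrable (the sinc kernel is admissible).  Integrability of \<open>\<phi>\<close> is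
  stated explicitly since the integral of a non-integrable function is \<open>0\<close>.\<close>

definition kernel_with_ft :: "(real \<Rightarrow> real) \<Rightarrow> (real \<Rightarrow> complex) \<Rightarrow> bool" where
  "kernel_with_ft w \<phi> \<longleftrightarrow>
     complex_integrable lborel \<phi> \<and>
     (\<forall>x. complex_of_real (w x) = 1 / (2 * pi) * (CLINT t|lborel. iexp (- (t * x)) * \<phi> t))"

definition emp_cf :: "nat \<Rightarrow> (nat \<Rightarrow> real) \<Rightarrow> real \<Rightarrow> complex" where
  "emp_cf n X t = (\<Sum>j = 1..n. iexp (t * X j)) / of_nat n"

text \<open>When \<open>\<phi>\<^sub>w\<close> is the Fourier transform of a real symmetric kernel and \<open>\<phi>\<^sub>k\<close> is a
  characteristic function, the integrand at \<open>- t\<close> is, for almost all \<open>t\<close>, the complex conjugate of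
  the integrand at \<open>t\<close>.  The integral is then a real number, and \<^const>\<open>Re\<close> only changes the type.\<close>

definition deconv_kde ::
    "(real \<Rightarrow> complex) \<Rightarrow> (real \<Rightarrow> complex) \<Rightarrow> real \<Rightarrow> real \<Rightarrow> nat \<Rightarrow> (nat \<Rightarrow> real) \<Rightarrow> real \<Rightarrow> real" where
  "deconv_kde \<phi>\<^sub>w \<phi>\<^sub>k h \<sigma> n X x =
     Re (1 / (2 * pi) *
       (CLINT t|lborel. iexp (- (t * x)) * (\<phi>\<^sub>w (h * t) * emp_cf n X t / \<phi>\<^sub>k (\<sigma> * t))))"

text \<open>Mutual independence of the \<open>2 n\<close> variables \<open>Y 1, \<dots>, Y n, Z 1, \<dots>, Z n\<close> is expressed over the
  disjoint union of the two index sets.\<close>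

definition deconv_sample ::
    "'a measure \<Rightarrow> (real \<Rightarrow> real) \<Rightarrow> (real \<Rightarrow> real) \<Rightarrow> nat \<Rightarrow>
     (nat \<Rightarrow> 'a \<Rightarrow> real) \<Rightarrow> (nat \<Rightarrow> 'a \<Rightarrow> real) \<Rightarrow> bool" where
  "deconv_sample M f k n Y Z \<longleftrightarrow>
     prob_space M \<and>
     (\<forall>j\<in>{1..n}. distributed M lborel (Y j) f) \<and>
     (\<forall>j\<in>{1..n}. distributed M lborel (Z j) k) \<and>
     prob_space.indep_vars M (\<lambda>_. borel) (case_sum Y Z) ({1..n} <+> {1..n})"

text \<open>\<^const>\<open>normal_density\<close> takes the standard deviation as its parameter and is not a probability
  density when that is \<open>0\<close>, so the degenerate case is separate.\<close>

definition normal_law :: "real \<Rightarrow> real \<Rightarrow> real measure" where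
  "normal_law m v =
     (if v = 0 then return borel m else density lborel (\<lambda>x. ennreal (normal_density m (sqrt v) x)))"

end

theory Submission
  imports Defs "HOL-Real_Asymp.Real_Asymp"
begin

text \<open>
  Substituting \<open>s = h t\<close>, the estimator is \<open>1/(n h)\<close> times the sum over \<open>j\<close> of
  \<open>1/(2 \<pi>) \<integral> exp(i s u\<^sub>j) \<phi>\<^sub>w(s) / \<phi>\<^sub>k(s/\<rho>) ds\<close> with \<open>u\<^sub>j = (X\<^sub>j - x)/h\<close>.  As \<open>\<rho> \<rightarrow> 0\<close> the factor
  \<open>1/\<phi>\<^sub>k(s/\<rho>)\<close> concentrates all the mass within distance \<open>\<rho>\<^sup>\<lambda>\<close> of the edges \<open>s = 1\<close> and \<open>s = -1\<close>: writing
  \<open>s = 1 - \<rho>\<^sup>\<lambda> v\<close>, the normalised integrand converges to \<open>(A/C) v\<^sup>\<alpha> exp(-\<lambda> v/\<mu>)\<close> and is dominated by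
  a multiple of \<open>v\<^sup>\<alpha> exp(-v/(2 \<mu>))\<close>.  Since \<open>\<rho>\<^sup>\<lambda>/h \<rightarrow> 0\<close>, the oscillating factor is constant at this scale,
  so each normalised summand is, up to a vanishing error, a constant multiple of \<open>cos((X\<^sub>j - x)/h)\<close>.  Its
  variance tends to one half of the squared constant, because the characteristic function of \<open>X\<^sub>j\<close> at \<open>c/h\<close> is at most
  \<open>\<bar>\<phi>\<^sub>k(c/\<rho>)\<bar> \<rightarrow> 0\<close>.  The normalised summands are uniformly bounded, so a central limit theorem for
  bounded triangular arrays gives the limit law.
\<close>

section \<open>Fourier uniqueness\<close>

text \<open>Both edges contribute equally, but the expansion of \<open>\<phi>\<^sub>w\<close> is
  given at 1 only. It reaches -1 through the symmetry of \<open>w\<close>; as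
  \<open>\<phi>\<^sub>w\<close> is tied to \<open>w\<close> only by an inversion integral, evenness
  holds merely almost everywhere and has to come from Fourier uniqueness. The edges yield iexp(u)
  and iexp(-u) with the same real constant, whence the cosine; with the factor 1/(2 \<pi>) of the
  inversion the sum becomes b cos u, and b^2/2 is the limiting variance.

  The obstacle is that freezing the oscillation is not uniform in u: its cost is of order |u|
  \<rho>^\<lambda>, and u = (X - x)/h is unbounded. Taking expectations leaves the rate
  \<rho>^\<lambda>/h times E|X - x|; here the second moments of Y and Z enter, as a bound for E|X -
  x| that is uniform in n. The boundedness behind the central limit theorem is a separate estimate.
  It does hold uniformly in u, because the oscillating factor has modulus 1, so no Lindeberg
  condition has to be checked although the law of a summand changes with n.\<close>

lemma integrable_iexp_mult:
  fixes g :: "real \<Rightarrow> complex"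
  assumes "complex_integrable lborel g"
  shows "complex_integrable lborel (\<lambda>t. iexp (t * x) * g t)"
proof -
  have [measurable]: "g \<in> borel_measurable borel" using assms by (auto dest: borel_measurable_integrable)
  show ?thesis
    by (rule Bochner_Integration.integrable_bound[OF assms]) (auto simp: norm_mult)
qed

lemma real_fourier_eq_0_imp_AE_eq_0:
  fixes u :: "real \<Rightarrow> real"
  assumes u: "integrable lborel u"
    and zero: "\<And>x. (CLINT t|lborel. iexp (x * t) * complex_of_real (u t)) = 0"
  shows "AE t in lborel. u t = 0"
proof -
  text \<open>The positive and negative parts of \<open>u\<close>, rescaled to probability densities, have the same
    characteristic function.\<close>
  define p q where "p t = max (u t) 0" and "q t = max (- u t) 0" for t
  have u_eq: "u t = p t - q t" for t by (auto simp: p_def q_def)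
  have p: "integrable lborel p" and q: "integrable lborel q"
    using u by (auto simp: p_def[abs_def] q_def[abs_def])
  have [measurable]: "p \<in> borel_measurable borel" "q \<in> borel_measurable borel"
    using p q by (auto dest: borel_measurable_integrable)
  have nonneg: "p t \<ge> 0" "q t \<ge> 0" for t by (auto simp: p_def q_def)
  define m where "m = (\<integral>t. p t \<partial>lborel)"
  \<comment> \<open>Frequency 0 shows that both parts have the same mass \<open>m\<close>, so one
    constant normalises both. The case \<open>m = 0\<close> is split off because then there is
    nothing to normalise.\<close>
  have "complex_of_real (\<integral>t. u t \<partial>lborel) = 0" using zero[of 0] by simp
  then have m: "(\<integral>t. q t \<partial>lborel) = m" using p q by (simp add: u_eq m_def)
  show ?thesis
  proof (cases "m = 0")
    case True
    then have "AE t in lborel. p t = 0" "AE t in lborel. q t = 0"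
      using m integral_nonneg_eq_0_iff_AE[OF p] integral_nonneg_eq_0_iff_AE[OF q] nonneg
      by (auto simp: m_def)
    then show ?thesis by eventually_elim (simp add: u_eq)
  next
    case False
    then have "m > 0" using nonneg by (simp add: m_def order_less_le integral_nonneg_AE)
    have dist: "real_distribution (density lborel (\<lambda>t. ennreal (r t / m)))"
      if r: "integrable lborel r" "\<And>t. r t \<ge> 0" "(\<integral>t. r t \<partial>lborel) = m" for r
    proof -
      have [measurable]: "r \<in> borel_measurable borel" using r by (auto dest: borel_measurable_integrable)
      have "(\<integral>\<^sup>+t. ennreal (r t / m) \<partial>lborel) = ennreal (\<integral>t. r t / m \<partial>lborel)"
        using r \<open>m > 0\<close> by (intro nn_integral_eq_integral) auto
      also have "\<dots> = 1" using r \<open>m > 0\<close> by simp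
      finally show ?thesis
        by (auto simp: real_distribution_def real_distribution_axioms_def emeasure_density intro!: prob_spaceI)
    qed
    have ch: "char (density lborel (\<lambda>t. ennreal (r t / m))) x
        = (CLINT t|lborel. iexp (x * t) * complex_of_real (r t)) / m"
      if [measurable]: "r \<in> borel_measurable borel" and "\<And>t. r t \<ge> 0" for r x
      unfolding char_def using that \<open>m > 0\<close>
      by (subst integral_density) (auto simp: scaleR_conv_of_real mult_ac simp flip: integral_divide_zero)
    have "density lborel (\<lambda>t. ennreal (p t / m)) = density lborel (\<lambda>t. ennreal (q t / m))"
    proof (rule Levy_uniqueness)
      show "char (density lborel (\<lambda>t. ennreal (p t / m))) = char (density lborel (\<lambda>t. ennreal (q t / m)))"
      proof
        fix x
        have "complex_integrable lborel (\<lambda>t. iexp (t * x) * complex_of_real (p t))"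
          "complex_integrable lborel (\<lambda>t. iexp (t * x) * complex_of_real (q t))"
          by (rule integrable_iexp_mult, use p q in simp)+
        then have "(CLINT t|lborel. iexp (x * t) * complex_of_real (p t))
            - (CLINT t|lborel. iexp (x * t) * complex_of_real (q t)) = 0"
          using zero[of x] by (simp add: u_eq algebra_simps)
        then show "char (density lborel (\<lambda>t. ennreal (p t / m))) x
            = char (density lborel (\<lambda>t. ennreal (q t / m))) x"
          using nonneg by (simp add: ch)
      qed
    qed (rule dist[OF p nonneg(1) m_def[symmetric]], rule dist[OF q nonneg(2) m])
    then have "AE t in lborel. ennreal (p t / m) = ennreal (q t / m)"
      by (intro sigma_finite_measure.density_unique[OF sigma_finite_lborel]) auto
    then show ?thesis
      by eventually_elim (use nonneg \<open>m > 0\<close> in \<open>auto simp: u_eq\<close>)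
  qed
qed

text \<open>Conjugating the hypothesis at \<open>- x\<close> shows that the transform of
  \<open>cnj (g t)\<close> vanishes as well. Real and imaginary part are linear combinations of
  \<open>g\<close> and its conjugate, which reduces the claim to real functions.\<close>

lemma fourier_eq_0_imp_AE_eq_0:
  fixes g :: "real \<Rightarrow> complex"
  assumes g: "complex_integrable lborel g"
    and zero: "\<And>x. (CLINT t|lborel. iexp (x * t) * g t) = 0"
  shows "AE t in lborel. g t = 0"
proof -
  have [measurable]: "g \<in> borel_measurable borel" using g by (auto dest: borel_measurable_integrable)
  have gx: "complex_integrable lborel (\<lambda>t. iexp (x * t) * g t)" for x
    using integrable_iexp_mult[OF g, of x] by (simp add: mult.commute)
  have gc: "complex_integrable lborel (\<lambda>t. iexp (x * t) * cnj (g t))" for x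
    using gx[of "- x"] by (subst complex_integrable_cnj[symmetric]) (simp add: exp_cnj)
  have cnj: "(CLINT t|lborel. iexp (x * t) * cnj (g t)) = 0" for x
  proof -
    have "(CLINT t|lborel. iexp (x * t) * cnj (g t)) = cnj (CLINT t|lborel. iexp (- x * t) * g t)"
      by (subst Bochner_Integration.integral_cnj[symmetric]) (simp add: exp_cnj del: Bochner_Integration.integral_cnj)
    then show ?thesis using zero[of "- x"] by simp
  qed
  have "AE t in lborel. Re (g t) = 0"
  proof (rule real_fourier_eq_0_imp_AE_eq_0)
    show "(CLINT t|lborel. iexp (x * t) * complex_of_real (Re (g t))) = 0" for x
    proof -
      have "(CLINT t|lborel. iexp (x * t) * complex_of_real (Re (g t)))
          = (CLINT t|lborel. (iexp (x * t) * g t + iexp (x * t) * cnj (g t)) / 2)"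
        by (simp add: complex_add_cnj flip: distrib_left)
      also have "\<dots> = 0" using gx gc zero cnj by simp
      finally show ?thesis .
    qed
  qed (use g in auto)
  moreover have "AE t in lborel. Im (g t) = 0"
  proof (rule real_fourier_eq_0_imp_AE_eq_0)
    show "(CLINT t|lborel. iexp (x * t) * complex_of_real (Im (g t))) = 0" for x
    proof -
      have "(CLINT t|lborel. iexp (x * t) * complex_of_real (Im (g t)))
          = (CLINT t|lborel. (iexp (x * t) * g t - iexp (x * t) * cnj (g t)) / (2 * \<i>))"
        unfolding right_diff_distrib[symmetric] times_divide_eq_right[symmetric]
        by (intro Bochner_Integration.integral_cong refl) (simp add: complex_diff_cnj mult.commute[of _ "\<i>"])
      also have "\<dots> = 0" using gx gc zero cnj by simp
      finally show ?thesis .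
    qed
  qed (use g in auto)
  ultimately show ?thesis by eventually_elim (simp add: complex_eq_iff)
qed

text \<open>\<open>\<phi>\<close> and its reflection are integrable and have the same Fourier
  integral at every point, because that integral is a multiple of the symmetric \<open>w\<close>.
  The lemma carries the behaviour of \<open>\<phi>\<close> at the edge 1 over to the edge
  -1.\<close>

lemma kernel_ft_even:
  assumes kernel: "kernel_with_ft w \<phi>" and sym: "\<And>u. w (- u) = w u"
  shows "AE t in lborel. \<phi> (- t) = \<phi> t"
proof -
  have \<phi>: "complex_integrable lborel \<phi>"
    and inv: "\<And>x. complex_of_real (w x) = 1 / (2 * pi) * (CLINT t|lborel. iexp (- (t * x)) * \<phi> t)"
    using kernel by (auto simp: kernel_with_ft_def)
  have \<phi>': "complex_integrable lborel (\<lambda>t. \<phi> (- t))"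
    using lborel_integrable_real_affine[OF \<phi>, of "-1" 0] by simp
  have "AE t in lborel. \<phi> (- t) - \<phi> t = 0"
  proof (rule fourier_eq_0_imp_AE_eq_0)
    fix x
    have ft: "(CLINT t|lborel. iexp (x * t) * \<phi> t) = 2 * pi * w x" for x
      using inv[of "- x"] sym[of x] by (simp add: mult.commute)
    have "(CLINT t|lborel. iexp (x * t) * \<phi> (- t)) = (CLINT t|lborel. iexp (- x * t) * \<phi> t)"
      by (subst lborel_integral_real_affine[of "-1" _ 0]) auto
    also have "\<dots> = (CLINT t|lborel. iexp (x * t) * \<phi> t)"
      by (simp only: ft sym)
    finally show "(CLINT t|lborel. iexp (x * t) * (\<phi> (- t) - \<phi> t)) = 0"
      using integrable_iexp_mult[OF \<phi>, of x] integrable_iexp_mult[OF \<phi>', of x]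
      by (simp add: right_diff_distrib mult.commute[of x])
  qed (use \<phi> \<phi>' in auto)
  then show ?thesis by eventually_elim simp
qed

section \<open>Triangular arrays of bounded variables\<close>

lemma real_distribution_normal_law: "0 \<le> v \<Longrightarrow> real_distribution (normal_law m v)"
  by (auto simp: normal_law_def real_distribution_def real_distribution_axioms_def
      intro!: prob_space_return prob_space_normal_density)

lemma char_normal_law:
  assumes "0 \<le> v"
  shows "char (normal_law 0 v) t = exp (- (t\<^sup>2 * v) / 2)"
proof (cases "v = 0")
  case True
  then show ?thesis
    by (simp add: char_def normal_law_def integral_return)
next
  case False
  with assms have v: "sqrt v > 0" by simp
  interpret std: prob_space std_normal_distribution
    by (rule prob_space_normal_density) simp
  have "distributed std_normal_distribution lborel (\<lambda>x. x) std_normal_density"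
    by (auto simp: distributed_def intro: distr_id2)
  then have "distributed std_normal_distribution lborel (\<lambda>x. sqrt v * x) (normal_density 0 (sqrt v))"
    using std.normal_density_affine[of "\<lambda>x. x" 0 1 "sqrt v" 0] v by simp
  then have eq: "normal_law 0 v = distr std_normal_distribution lborel (\<lambda>x. sqrt v * x)"
    using False by (simp add: normal_law_def distributed_distr_eq_density)
  have "char (normal_law 0 v) t = char std_normal_distribution (t * sqrt v)"
    unfolding eq char_def by (subst integral_distr) (auto simp: algebra_simps)
  also have "\<dots> = exp (- (t\<^sup>2 * v) / 2)"
    using assms by (simp add: char_std_normal_distribution power_mult_distrib)
  finally show ?thesis .
qed

text \<open>By independence the characteristic function of the normalised sum at t is the n-th power
  of that of \<open>P n\<close> at t / sqrt n, so it suffices to compare one factor with 1 - t^2 v /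
  (2 n). A fixed bound \<open>B\<close> controls the cubic Taylor remainder in every row. It is only
  asked for eventually, because the edge estimates need \<rho> < 1. The degenerate limit
  \<open>v = 0\<close> is included.\<close>

lemma triangular_bounded_clt:
  fixes X :: "nat \<Rightarrow> nat \<Rightarrow> 'a \<Rightarrow> real" and P :: "nat \<Rightarrow> real measure"
  assumes M: "\<And>n. prob_space (M n)"
    and ind: "\<And>n. prob_space.indep_vars (M n) (\<lambda>_. borel) (X n) {1..n}"
    and P: "\<And>n. real_distribution (P n)"
    and dist: "\<And>n j. j \<in> {1..n} \<Longrightarrow> distr (M n) borel (X n j) = P n"
    and bdd: "\<forall>\<^sub>F n in sequentially. AE y in P n. \<bar>y\<bar> \<le> B"
    and mean: "\<forall>\<^sub>F n in sequentially. (\<integral>y. y \<partial>P n) = 0"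
    and var: "(\<lambda>n. \<integral>y. y\<^sup>2 \<partial>P n) \<longlonglongrightarrow> v"
  shows "weak_conv_m (\<lambda>n. distr (M n) borel (\<lambda>\<omega>. (\<Sum>j = 1..n. X n j \<omega>) / sqrt (real n))) (normal_law 0 v)"
proof (rule levy_continuity)
  have rv: "X n j \<in> borel_measurable (M n)" if "j \<in> {1..n}" for n j
    using ind[of n] that by (auto simp: prob_space.indep_vars_def2[OF M])
  show "real_distribution (distr (M n) borel (\<lambda>\<omega>. (\<Sum>j = 1..n. X n j \<omega>) / sqrt (real n)))" for n
    using rv by (intro prob_space.real_distribution_distr[OF M]) auto
  have v: "v \<ge> 0"
    by (rule LIMSEQ_le_const[OF var]) (auto intro!: integral_nonneg_AE)
  then show "real_distribution (normal_law 0 v)" by (rule real_distribution_normal_law)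
  show "(\<lambda>n. char (distr (M n) borel (\<lambda>\<omega>. (\<Sum>j = 1..n. X n j \<omega>) / sqrt (real n))) t)
      \<longlonglongrightarrow> char (normal_law 0 v) t" for t
  proof -
    let ?\<phi> = "\<lambda>n. char (distr (M n) borel (\<lambda>\<omega>. (\<Sum>j = 1..n. X n j \<omega>) / sqrt (real n))) t"
    let ?v = "\<lambda>n. \<integral>y. y\<^sup>2 \<partial>P n"
    \<comment> \<open>This range of n puts 1 - t^2 v / (2 n) into [-1, 1]. Powers of two numbers in
      the closed unit disc differ by at most n times the difference of the bases, and
      \<open>norm_power_diff\<close> needs both bases there.\<close>
    have large: "\<forall>\<^sub>F n in sequentially. real n \<ge> t\<^sup>2 * v / 4"
      by (rule eventually_compose_filterlim[OF eventually_ge_at_top filterlim_real_sequentially])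
    have main: "\<forall>\<^sub>F n in sequentially. cmod (?\<phi> n - complex_of_real ((1 + (- (t\<^sup>2 * v) / 2) / n) ^ n))
        \<le> \<bar>t\<bar> ^ 3 * B ^ 3 / 6 / sqrt n + t\<^sup>2 * \<bar>?v n - v\<bar> / 2"
      using bdd mean large eventually_gt_at_top[of 0]
    proof eventually_elim
      case (elim n)
      interpret M: prob_space "M n" by (rule M)
      interpret P: real_distribution "P n" by (rule P)
      define s where "s = t / sqrt n"
      have n: "real n > 0" using elim by simp
      have s2: "s\<^sup>2 = t\<^sup>2 / n" using n by (simp add: s_def power_divide)
      have B: "B \<ge> 0"
      proof (rule ccontr)
        assume "\<not> B \<ge> 0"
        then have "AE y in P n. False" by (intro eventually_mono[OF elim(1)]) auto
        then show False by simp
      qed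
      have i1: "integrable (P n) (\<lambda>y. y)"
        using elim(1) by (intro P.integrable_const_bound[of _ B]) auto
      have i2: "integrable (P n) (\<lambda>y. y\<^sup>2)"
        using elim(1) B by (intro P.integrable_const_bound[of _ "B\<^sup>2"])
          (auto elim!: eventually_mono simp: abs_le_square_iff[symmetric])
      have "?\<phi> n = char (distr (M n) borel (\<lambda>\<omega>. \<Sum>j = 1..n. X n j \<omega> / sqrt n)) t"
        by (simp add: sum_divide_distrib)
      also have "\<dots> = (\<Prod>j = 1..n. char (distr (M n) borel (\<lambda>\<omega>. X n j \<omega> / sqrt n)) t)"
        by (intro M.char_distr_sum M.indep_vars_compose2[OF ind]) auto
      also have "\<dots> = (\<Prod>j = 1..n. char (P n) s)"
      proof (rule prod.cong)
        fix j assume j: "j \<in> {1..n}"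
        note [measurable] = rv[OF j]
        show "char (distr (M n) borel (\<lambda>\<omega>. X n j \<omega> / sqrt n)) t = char (P n) s"
          unfolding char_def dist[OF j, symmetric] by (simp add: integral_distr s_def)
      qed simp
      finally have \<phi>: "?\<phi> n = char (P n) s ^ n" by simp
      have "cmod (char (P n) s - (1 - s\<^sup>2 * ?v n / 2))
          \<le> s\<^sup>2 / 6 * P.expectation (\<lambda>x. min (6 * x\<^sup>2) (\<bar>s\<bar> * \<bar>x\<bar> ^ 3))"
        using elim(2) by (intro P.char_approx3 i1 i2) auto
      \<comment> \<open>The cubic branch of the minimum is kept: with s = t / sqrt n it makes the
        error of one factor of order n^(-3/2), so that n factors together contribute
        n^(-1/2).\<close>
      also have "\<dots> \<le> s\<^sup>2 / 6 * (\<bar>s\<bar> * B ^ 3)"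
      proof (intro mult_left_mono)
        have "AE x in P n. \<bar>min (6 * x\<^sup>2) (\<bar>s\<bar> * \<bar>x\<bar> ^ 3)\<bar> \<le> \<bar>s\<bar> * B ^ 3"
          using elim(1)
        proof eventually_elim
          case (elim x)
          have "min (6 * x\<^sup>2) (\<bar>s\<bar> * \<bar>x\<bar> ^ 3) \<le> \<bar>s\<bar> * \<bar>x\<bar> ^ 3" by simp
          also have "\<dots> \<le> \<bar>s\<bar> * B ^ 3" using elim by (intro mult_left_mono power_mono) auto
          finally show ?case by (simp add: abs_of_nonneg)
        qed
        then show "P.expectation (\<lambda>x. min (6 * x\<^sup>2) (\<bar>s\<bar> * \<bar>x\<bar> ^ 3)) \<le> \<bar>s\<bar> * B ^ 3"
          by (intro P.integral_le_const P.integrable_const_bound[of _ "\<bar>s\<bar> * B ^ 3"])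
            (auto elim!: eventually_mono)
      qed simp
      also have "s\<^sup>2 / 6 * (\<bar>s\<bar> * B ^ 3) = \<bar>t\<bar> ^ 3 * B ^ 3 / 6 / sqrt n / n"
        unfolding s2 by (simp add: s_def power3_eq_cube power2_eq_square ac_simps)
      finally have 1: "cmod (char (P n) s - complex_of_real (1 - s\<^sup>2 * ?v n / 2)) \<le> \<bar>t\<bar> ^ 3 * B ^ 3 / 6 / sqrt n / n"
        by simp
      have 2: "cmod (complex_of_real (1 - s\<^sup>2 * ?v n / 2) - complex_of_real (1 + (- (t\<^sup>2 * v) / 2) / n))
          = t\<^sup>2 * \<bar>?v n - v\<bar> / 2 / n"
      proof -
        have "(1 - s\<^sup>2 * ?v n / 2) - (1 + (- (t\<^sup>2 * v) / 2) / n) = - (t\<^sup>2 / 2 / n * (?v n - v))"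
          using n by (simp add: s2 field_simps)
        then show ?thesis
          using n unfolding of_real_diff[symmetric] norm_of_real by (simp add: abs_mult)
      qed
      have 3: "cmod (complex_of_real (1 + (- (t\<^sup>2 * v) / 2) / n)) \<le> 1"
        unfolding norm_of_real using n elim(3) v by (auto intro!: abs_leI simp: divide_le_eq)
      have "cmod (?\<phi> n - complex_of_real (1 + (- (t\<^sup>2 * v) / 2) / n) ^ n)
          \<le> n * cmod (char (P n) s - complex_of_real (1 + (- (t\<^sup>2 * v) / 2) / n))"
        unfolding \<phi> by (intro norm_power_diff P.cmod_char_le_1 3)
      also have "\<dots> \<le> n * (\<bar>t\<bar> ^ 3 * B ^ 3 / 6 / sqrt n / n + t\<^sup>2 * \<bar>?v n - v\<bar> / 2 / n)"
        by (intro mult_left_mono norm_diff_triangle_le[OF 1] eq_refl[OF 2]) simp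
      also have "\<dots> = \<bar>t\<bar> ^ 3 * B ^ 3 / 6 / sqrt n + t\<^sup>2 * \<bar>?v n - v\<bar> / 2"
        using n by (simp add: field_simps)
      finally show ?case by simp
    qed
    have "(\<lambda>n. \<bar>t\<bar> ^ 3 * B ^ 3 / 6 / sqrt (real n) + t\<^sup>2 * \<bar>?v n - v\<bar> / 2) \<longlonglongrightarrow> 0 + t\<^sup>2 * \<bar>v - v\<bar> / 2"
      by (intro tendsto_add tendsto_mult tendsto_divide tendsto_const tendsto_rabs tendsto_diff var
          tendsto_divide_0[OF tendsto_const] filterlim_at_top_imp_at_infinity
          filterlim_compose[OF sqrt_at_top filterlim_real_sequentially]) auto
    then have err: "(\<lambda>n. \<bar>t\<bar> ^ 3 * B ^ 3 / 6 / sqrt (real n) + t\<^sup>2 * \<bar>?v n - v\<bar> / 2) \<longlonglongrightarrow> 0" by simp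
    have "(\<lambda>n. complex_of_real ((1 + (- (t\<^sup>2 * v) / 2) / n) ^ n)) \<longlonglongrightarrow> complex_of_real (exp (- (t\<^sup>2 * v) / 2))"
      by (rule isCont_tendsto_compose[OF _ tendsto_exp_limit_sequentially]) auto
    then have "?\<phi> \<longlonglongrightarrow> complex_of_real (exp (- (t\<^sup>2 * v) / 2))"
      by (rule Lim_transform) (rule Lim_null_comparison[OF main err])
    then show ?thesis by (simp add: char_normal_law[OF v] exp_of_real)
  qed
qed

section \<open>Concentration of the deconvolution integral at the edges\<close>

lemma bounded_of_tendsto_at_infinity:
  fixes f :: "real \<Rightarrow> real"
  assumes cont: "continuous_on UNIV f" and lim: "(f \<longlongrightarrow> l) at_infinity"
  shows "\<exists>K>0. \<forall>y. f y \<le> K"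
proof -
  have "\<forall>\<^sub>F y in at_infinity. f y < l + 1"
    using lim by (rule order_tendstoD) simp
  then obtain b where b: "\<And>y. b \<le> norm y \<Longrightarrow> f y < l + 1"
    by (auto simp: eventually_at_infinity)
  have "bounded (f ` {-b..b})"
    by (intro compact_imp_bounded compact_continuous_image continuous_on_subset[OF cont]) auto
  then obtain B where B: "\<And>y. y \<in> {-b..b} \<Longrightarrow> \<bar>f y\<bar> \<le> B"
    by (force simp: bounded_iff)
  show ?thesis
  proof (intro exI[of _ "\<bar>l\<bar> + 1 + \<bar>B\<bar>"] conjI allI)
    show "f y \<le> \<bar>l\<bar> + 1 + \<bar>B\<bar>" for y
      using b[of y] B[of y] by (cases "b \<le> norm y") (auto simp: abs_if split: if_splits)
  qed auto
qed

text \<open>The base grows linearly, hence is at most a constant times exp (d v) for any positive d,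
  and d can be taken so small that the power \<open>b\<close> stays below exp (c v). The base 2 + 2
  v is the one that bounds both \<rho> + s and its reciprocal in the edge estimate.\<close>

lemma powr_le_exp_bound:
  fixes b c :: real
  assumes "b \<ge> 0" "c > 0"
  shows "\<exists>K>0. \<forall>v\<ge>0. (2 + 2 * v) powr b \<le> K * exp (c * v)"
proof -
  \<comment> \<open>Dividing by \<open>b + 1\<close> and not by \<open>b\<close> gives
    \<open>b * d \<le> c\<close> and also covers \<open>b = 0\<close>.\<close>
  define d where "d = c / (b + 1)"
  define m where "m = max 1 (1 / d)"
  have d: "d > 0" using assms by (simp add: d_def)
  have m: "m \<ge> 1" "m * d \<ge> 1"
  proof -
    have "1 = 1 / d * d" using d by simp
    also have "\<dots> \<le> m * d" using d by (intro mult_right_mono) (auto simp: m_def)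
    finally show "m * d \<ge> 1" .
  qed (simp add: m_def)
  show ?thesis
  proof (intro exI[of _ "(2 * m) powr b"] conjI allI impI)
    fix v :: real assume v: "v \<ge> 0"
    have "1 * v \<le> m * d * v" using m v by (intro mult_right_mono) auto
    then have "2 + 2 * v \<le> 2 * m * (1 + d * v)" using m by (simp add: algebra_simps)
    also have "\<dots> \<le> 2 * m * exp (d * v)"
      using m by (intro mult_left_mono) (auto simp: add.commute)
    finally have "(2 + 2 * v) powr b \<le> (2 * m * exp (d * v)) powr b"
      using assms v by (intro powr_mono2) auto
    also have "\<dots> = (2 * m) powr b * exp (b * (d * v))"
      using m by (simp add: powr_mult powr_def[of "exp _"])
    also have "b * (d * v) \<le> c * v"
    proof -
      have "b * d \<le> c" using assms by (simp add: d_def field_simps)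
      then show ?thesis using mult_right_mono[OF _ v] by (simp add: mult.assoc[symmetric])
    qed
    finally show "(2 + 2 * v) powr b \<le> (2 * m) powr b * exp (c * v)"
      by (simp add: mult_left_mono)
  qed (use m in auto)
qed

lemma has_bochner_integral_Gamma:
  fixes a c :: real
  assumes "a \<ge> 0" "c > 0"
  shows "has_bochner_integral lborel (\<lambda>v. indicator {0<..} v * (v powr a * exp (- (c * v))))
           (Gamma (a + 1) / c powr (a + 1))"
proof -
  let ?f = "\<lambda>t::real. indicator {0..} t * t powr a / exp t :: real"
  have "has_bochner_integral lborel ?f (Gamma (a + 1))"
  proof (rule has_bochner_integral_nn_integral)
    show "(\<integral>\<^sup>+t. ennreal (?f t) \<partial>lborel) = ennreal (Gamma (a + 1))"
      using Gamma_conv_nn_integral_real[of "a + 1"] assms by simp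
  qed (use assms in \<open>auto intro!: less_imp_le Gamma_real_pos\<close>)
  then have "has_bochner_integral lborel (\<lambda>v. ?f (0 + c * v)) (Gamma (a + 1) /\<^sub>R \<bar>c\<bar>)"
    using assms by (subst (asm) lborel_has_bochner_integral_real_affine_iff[of c _ _ 0]) auto
  then have "has_bochner_integral lborel (\<lambda>v. ?f (0 + c * v) / c powr a) (Gamma (a + 1) /\<^sub>R \<bar>c\<bar> / c powr a)"
    by (rule has_bochner_integral_divide_zero)
  \<comment> \<open>The closed half-line turns into the open one pointwise: at \<open>v = 0\<close>
    both sides vanish since \<open>0 powr a = 0\<close>, even for \<open>a = 0\<close>.\<close>
  moreover have "?f (0 + c * v) / c powr a = indicator {0<..} v * (v powr a * exp (- (c * v)))" for v
    using assms by (cases "v = 0") (auto simp: powr_mult exp_minus field_simps zero_le_mult_iff split: split_indicator)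
  moreover have "Gamma (a + 1) /\<^sub>R \<bar>c\<bar> / c powr a = Gamma (a + 1) / c powr (a + 1)"
    using assms by (simp add: powr_add field_simps)
  ultimately show ?thesis by simp
qed

lemma norm_iexp_diff_le: "norm (iexp a - iexp b) \<le> \<bar>a - b\<bar>"
proof -
  have "iexp a - iexp b = iexp b * (iexp (a - b) - 1)"
    by (simp add: algebra_simps flip: exp_add)
  then show ?thesis using iexp_approx1[of "a - b" 0] by (simp add: norm_mult)
qed

text \<open>Dominated convergence needs a bound for all t > 0, not only near 0. For t < d the o-term
  is at most \<open>t powr \<alpha>\<close>, which gives |A| + 1; for t \<ge> d the norm is at most
  1 while \<open>t powr \<alpha>\<close> is at least \<open>d powr \<alpha>\<close>, which gives the
  third term of the constant.\<close>

lemma edge_bound: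
  fixes \<phi> :: "real \<Rightarrow> complex"
  assumes le: "\<And>t. norm (\<phi> t) \<le> 1" and \<alpha>: "\<alpha> \<ge> 0"
    and edge: "(\<lambda>t. \<phi> (1 - t) - complex_of_real (A * t powr \<alpha>))
      \<in> o[at_right 0](\<lambda>t. complex_of_real (t powr \<alpha>))"
  shows "\<exists>K>0. \<forall>t>0. norm (\<phi> (1 - t)) \<le> K * t powr \<alpha>"
proof -
  have "\<forall>\<^sub>F t in at_right 0. norm (\<phi> (1 - t) - complex_of_real (A * t powr \<alpha>)) \<le> 1 * norm (complex_of_real (t powr \<alpha>))"
    by (rule landau_o.smallD[OF edge]) simp
  then obtain d where d: "d > 0" "\<And>t. 0 < t \<Longrightarrow> t < d \<Longrightarrow>
      norm (\<phi> (1 - t) - complex_of_real (A * t powr \<alpha>)) \<le> t powr \<alpha>"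
    by (auto simp: eventually_at_right_field)
  show ?thesis
  proof (intro exI[of _ "\<bar>A\<bar> + 1 + d powr (- \<alpha>)"] conjI allI impI)
    fix t :: real assume t: "t > 0"
    show "norm (\<phi> (1 - t)) \<le> (\<bar>A\<bar> + 1 + d powr (- \<alpha>)) * t powr \<alpha>"
    proof (cases "t < d")
      case True
      have "norm (\<phi> (1 - t)) \<le> norm (\<phi> (1 - t) - complex_of_real (A * t powr \<alpha>)) + norm (complex_of_real (A * t powr \<alpha>))"
        using norm_triangle_ineq[of "\<phi> (1 - t) - complex_of_real (A * t powr \<alpha>)" "complex_of_real (A * t powr \<alpha>)"]
        by simp
      also have "\<dots> \<le> t powr \<alpha> + \<bar>A\<bar> * t powr \<alpha>"
        unfolding norm_of_real using d(2)[OF t True] by (simp add: abs_mult)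
      also have "\<dots> \<le> (\<bar>A\<bar> + 1 + d powr (- \<alpha>)) * t powr \<alpha>"
        by (simp add: algebra_simps)
      finally show ?thesis .
    next
      case False
      then have "d powr \<alpha> \<le> t powr \<alpha>" using d \<alpha> by (intro powr_mono2) auto
      then have "1 \<le> d powr (- \<alpha>) * t powr \<alpha>" using d by (simp add: powr_minus field_simps)
      moreover have "0 \<le> \<bar>A\<bar> * t powr \<alpha> + t powr \<alpha>" by simp
      ultimately show ?thesis using le[of "1 - t"] unfolding distrib_right by linarith
    qed
  qed (simp add: add_pos_nonneg)
qed

text \<open>The limit is minus the derivative of (1 - t v)^lam at t = 0. With \<open>m n\<close>
  equal to \<rho>^lam this is the first-order expansion of the exponent at the edge, and the origin
  of the rate \<open>lam / \<mu>\<close> in the limiting exponential.\<close>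

lemma tendsto_edge_rate:
  fixes m :: "nat \<Rightarrow> real"
  assumes m: "m \<longlonglongrightarrow> 0" "\<And>n. m n > (0::real)" and v: "v > 0" and lam: "lam > 1"
  shows "(\<lambda>n. (1 - (1 - m n * v) powr lam) / m n) \<longlonglongrightarrow> lam * v"
proof -
  have "((\<lambda>t. (1 - t * v) powr lam) has_real_derivative - (lam * v)) (at 0)"
    by (auto intro!: derivative_eq_intros)
  then have "((\<lambda>t. ((1 - t * v) powr lam - 1) / t) \<longlongrightarrow> - (lam * v)) (at 0)"
    by (simp add: has_field_derivative_iff)
  then have "(\<lambda>n. ((1 - m n * v) powr lam - 1) / m n) \<longlonglongrightarrow> - (lam * v)"
    by (rule filterlim_compose) (use m in \<open>auto simp: filterlim_at less_imp_neq[symmetric]\<close>)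
  from tendsto_minus[OF this] show ?thesis by (simp add: minus_divide_left)
qed

section \<open>Global control of a zero-free function with a supersmooth tail\<close>

locale supersmooth_cf =
  fixes \<phi>\<^sub>k :: "real \<Rightarrow> complex" and lam lam0 \<mu> C :: real
  assumes k_cont: "continuous_on UNIV \<phi>\<^sub>k"
    and k_nz: "\<And>t. \<phi>\<^sub>k t \<noteq> 0"
    and k_tail: "\<phi>\<^sub>k \<sim>[at_infinity]
      (\<lambda>t. complex_of_real (C * \<bar>t\<bar> powr lam0 * exp (- (\<bar>t\<bar> powr lam) / \<mu>)))"
    and lam: "lam > 1" and \<mu>: "\<mu> > 0"
begin
text \<open>Asymptotic equivalence sets the quotient to 1 where both functions vanish. As
  \<open>\<phi>\<^sub>k\<close> has no zeros, this convention never applies and an ordinary limit of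
  quotients remains.\<close>

lemma cf_over_tail:
  "((\<lambda>t. \<phi>\<^sub>k t / complex_of_real (C * \<bar>t\<bar> powr lam0 * exp (- (\<bar>t\<bar> powr lam) / \<mu>))) \<longlongrightarrow> 1) at_infinity"
  using k_tail by (simp only: asymp_equiv_def k_nz simp_thms if_False)

text \<open>For \<open>C = 0\<close> every quotient would be a division by zero, with value 0, and
  could not tend to 1.\<close>

lemma cf_tail_const_nz: "C \<noteq> 0"
proof
  assume "C = 0"
  then have "(\<lambda>t. \<phi>\<^sub>k t / complex_of_real (C * \<bar>t\<bar> powr lam0 * exp (- (\<bar>t\<bar> powr lam) / \<mu>))) = (\<lambda>_. 0)"
    by simp
  from tendsto_unique[OF trivial_limit_at_infinity cf_over_tail[unfolded this] tendsto_const]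
  show False by simp
qed

lemma cf_tail_ratio:
  "((\<lambda>t. complex_of_real (\<bar>t\<bar> powr lam0 * exp (- (\<bar>t\<bar> powr lam) / \<mu>)) / \<phi>\<^sub>k t) \<longlongrightarrow> 1 / C) at_infinity"
proof -
  have "((\<lambda>t. inverse (\<phi>\<^sub>k t / complex_of_real (C * \<bar>t\<bar> powr lam0 * exp (- (\<bar>t\<bar> powr lam) / \<mu>))) / C)
      \<longlongrightarrow> inverse 1 / complex_of_real C) at_infinity"
    using cf_tail_const_nz by (intro tendsto_intros cf_over_tail) auto
  then show ?thesis
    using cf_tail_const_nz by (simp add: field_simps del: of_real_mult) (simp add: field_simps)
qed

text \<open>The tail is replaced by \<open>?G\<close>, with 1 + |y| in place of |y|, because this is
  continuous and positive at 0 for either sign of \<open>lam0\<close>. Then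
  \<open>?G y / \<phi>\<^sub>k y\<close> is continuous with a finite limit at infinity, hence
  bounded.\<close>

lemma inverse_cf_bound:
  "\<exists>K>0. \<forall>y. norm (1 / \<phi>\<^sub>k y) \<le> K * ((1 + \<bar>y\<bar>) powr (- lam0) * exp (\<bar>y\<bar> powr lam / \<mu>))"
proof -
  let ?G = "\<lambda>y. (1 + \<bar>y\<bar>) powr lam0 * exp (- (\<bar>y\<bar> powr lam) / \<mu>)"
  let ?f = "\<lambda>y. norm (?G y / \<phi>\<^sub>k y)"
  have "continuous_on UNIV ?f"
    using lam \<mu> k_nz by (intro continuous_intros k_cont continuous_on_powr') auto
  moreover have "(?f \<longlongrightarrow> norm (1 powr lam0 * (1 / C))) at_infinity"
  proof -
    \<comment> \<open>This factor is the quotient of (1 + |y|)^lam0 by |y|^lam0, which converts the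
      known limit for the tail into one for \<open>?G\<close>.\<close>
    have t: "((\<lambda>y. (1 + \<bar>inverse y\<bar>) powr lam0) \<longlongrightarrow> (1 + \<bar>0\<bar>) powr lam0) (at_infinity :: real filter)"
      by (intro tendsto_powr tendsto_add tendsto_rabs tendsto_const tendsto_inverse_0) auto
    have "((\<lambda>y. norm (complex_of_real ((1 + \<bar>inverse y\<bar>) powr lam0) *
        (complex_of_real (\<bar>y\<bar> powr lam0 * exp (- (\<bar>y\<bar> powr lam) / \<mu>)) / \<phi>\<^sub>k y)))
        \<longlongrightarrow> norm (complex_of_real ((1 + \<bar>0\<bar>) powr lam0) * (1 / C))) at_infinity"
      by (intro tendsto_norm tendsto_mult tendsto_of_real t cf_tail_ratio)
    then show ?thesis
    proof (rule Lim_transform_eventually[THEN tendsto_eq_rhs])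
      have "\<forall>\<^sub>F y::real in at_infinity. \<bar>y\<bar> \<ge> 1"
        by (auto simp: eventually_at_infinity)
      then show "\<forall>\<^sub>F y in at_infinity. norm (complex_of_real ((1 + \<bar>inverse y\<bar>) powr lam0) *
          (complex_of_real (\<bar>y\<bar> powr lam0 * exp (- (\<bar>y\<bar> powr lam) / \<mu>)) / \<phi>\<^sub>k y)) = ?f y"
      proof eventually_elim
        case (elim y)
        have "(1 + \<bar>inverse y\<bar>) powr lam0 * \<bar>y\<bar> powr lam0 = ((1 + \<bar>inverse y\<bar>) * \<bar>y\<bar>) powr lam0"
          by (simp add: powr_mult)
        also have "(1 + \<bar>inverse y\<bar>) * \<bar>y\<bar> = 1 + \<bar>y\<bar>"
          using elim by (auto simp: field_simps)
        finally show ?case by (simp add: norm_mult norm_divide abs_mult)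
      qed
    qed (simp add: norm_divide)
  qed
  ultimately obtain K where K: "K > 0" "\<And>y. ?f y \<le> K"
    using bounded_of_tendsto_at_infinity by blast
  show ?thesis
  proof (intro exI[of _ K] conjI allI K(1))
    fix y
    have G: "?G y > 0" by simp
    have "norm (1 / \<phi>\<^sub>k y) = ?f y / ?G y"
      using G by (simp add: norm_divide norm_mult abs_mult)
    also have "\<dots> \<le> K / ?G y" using K G by (intro divide_right_mono) auto
    also have "\<dots> = K * ((1 + \<bar>y\<bar>) powr (- lam0) * exp (\<bar>y\<bar> powr lam / \<mu>))"
      by (simp add: powr_minus exp_minus field_simps)
    finally show "norm (1 / \<phi>\<^sub>k y) \<le> \<dots>" .
  qed
qed

end

section \<open>Domination and pointwise limit of the integrand at an edge\<close>

locale supersmooth_deconvolution = supersmooth_cf +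
  fixes \<phi>\<^sub>w :: "real \<Rightarrow> complex" and A \<alpha> :: real
  assumes w_meas: "\<phi>\<^sub>w \<in> borel_measurable borel"
    and w_le: "\<And>t. norm (\<phi>\<^sub>w t) \<le> 1"
    and w_supp: "\<And>t. t \<notin> {-1..1} \<Longrightarrow> \<phi>\<^sub>w t = 0"
    and w_even: "AE t in lborel. \<phi>\<^sub>w (- t) = \<phi>\<^sub>w t"
    and \<alpha>: "\<alpha> \<ge> 0"
    and w_edge: "(\<lambda>t. \<phi>\<^sub>w (1 - t) - complex_of_real (A * t powr \<alpha>))
      \<in> o[at_right 0](\<lambda>t. complex_of_real (t powr \<alpha>))"
begin
text \<open>The edge behaviour of \<open>\<phi>\<^sub>w\<close> supplies \<rho>^(lam \<alpha>)
  v^\<alpha>, and the exponential in 1 / \<open>\<phi>\<^sub>k\<close> supplies exp (1 / (\<mu>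
  \<rho>^lam)) exp (-v / \<mu>). The remaining power of 1 + s / \<rho> may grow with v; half of the
  exponential decay is spent on it, which leaves the rate 1 / (2 \<mu>).\<close>

lemma edge_weight_bound:
  "\<exists>K>0. \<forall>\<rho> v e. 0 < \<rho> \<longrightarrow> \<rho> \<le> 1 \<longrightarrow> 0 < v \<longrightarrow> \<rho> powr lam * v \<le> 1 \<longrightarrow> \<bar>e\<bar> = 1 \<longrightarrow>
     norm (\<phi>\<^sub>w (1 - \<rho> powr lam * v) / \<phi>\<^sub>k (e * (1 - \<rho> powr lam * v) / \<rho>))
     \<le> \<rho> powr (lam * \<alpha> + lam0) * exp (1 / (\<mu> * \<rho> powr lam)) * (K * (v powr \<alpha> * exp (- (1 / (2 * \<mu>) * v))))"
proof -
  obtain K1 where K1: "K1 > 0" "\<And>t. t > 0 \<Longrightarrow> norm (\<phi>\<^sub>w (1 - t)) \<le> K1 * t powr \<alpha>"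
    using edge_bound[OF w_le \<alpha> w_edge] by blast
  obtain K2 where K2: "K2 > 0"
    "\<And>y. norm (1 / \<phi>\<^sub>k y) \<le> K2 * ((1 + \<bar>y\<bar>) powr (- lam0) * exp (\<bar>y\<bar> powr lam / \<mu>))"
    using inverse_cf_bound by blast
  obtain K3 where K3: "K3 > 0"
    "\<And>v. v \<ge> 0 \<Longrightarrow> (2 + 2 * v) powr \<bar>lam0\<bar> \<le> K3 * exp (1 / (2 * \<mu>) * v)"
    using powr_le_exp_bound[of "\<bar>lam0\<bar>" "1 / (2 * \<mu>)"] \<mu> by auto
  show ?thesis
  proof (intro exI[of _ "K1 * K2 * K3"] conjI allI impI)
    fix \<rho> v e :: real
    assume \<rho>: "0 < \<rho>" "\<rho> \<le> 1" and v: "0 < v" and le1: "\<rho> powr lam * v \<le> 1" and e: "\<bar>e\<bar> = 1"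
    define m where "m = \<rho> powr lam"
    define s where "s = 1 - m * v"
    have m: "m > 0" using \<rho> by (simp add: m_def)
    have s: "0 \<le> s" "s < 1" using le1 m v by (auto simp: s_def m_def)
    have m_le: "m \<le> \<rho>" using powr_mono'[of 1 lam \<rho>] \<rho> lam by (simp add: m_def)
    have w: "norm (\<phi>\<^sub>w s) \<le> K1 * (\<rho> powr (lam * \<alpha>) * v powr \<alpha>)"
    proof -
      have "norm (\<phi>\<^sub>w s) \<le> K1 * (m * v) powr \<alpha>"
        unfolding s_def using m v by (intro K1) auto
      also have "(m * v) powr \<alpha> = \<rho> powr (lam * \<alpha>) * v powr \<alpha>"
        by (simp add: powr_mult m_def powr_powr)
      finally show ?thesis .
    qed
    have exp_le: "exp ((s / \<rho>) powr lam / \<mu>) \<le> exp (1 / (\<mu> * m)) * exp (- (v / \<mu>))"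
    proof -
      \<comment> \<open>For s in [0, 1] and lam > 1 the power is at most s itself, and s / m is
        exactly linear in v. The cost is a decay rate 1 / \<mu> in place of the true lam / \<mu>,
        which is enough for domination.\<close>
      have "s powr lam \<le> s powr 1" using s lam by (intro powr_mono') auto
      then have "(s / \<rho>) powr lam \<le> s / m"
        using s m by (simp add: powr_divide m_def divide_right_mono)
      also have "s / m = 1 / m - v" using m by (simp add: s_def field_simps)
      finally have "(s / \<rho>) powr lam / \<mu> \<le> (1 / m - v) / \<mu>" using \<mu> by (intro divide_right_mono) auto
      also have "\<dots> = 1 / (\<mu> * m) + - (v / \<mu>)" by (simp add: field_simps diff_divide_distrib)
      finally show ?thesis by (simp only: exp_le_cancel_iff flip: exp_add)
    qed
    have pow_le: "(1 + s / \<rho>) powr (- lam0) \<le> \<rho> powr lam0 * (K3 * exp (1 / (2 * \<mu>) * v))"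
    proof -
      let ?b = "2 + 2 * v"
      have "1 / (\<rho> + s) \<le> ?b"
      proof (cases "s \<ge> 1 / 2")
        case True
        then have "1 / (\<rho> + s) \<le> 1 / (1 / 2)" using \<rho> by (intro divide_left_mono) auto
        then show ?thesis using v by simp
      next
        case False
        then have "1 / m < 2 * v" using m by (simp add: s_def field_simps)
        moreover have "1 / (\<rho> + s) \<le> 1 / m" using m_le s m by (intro divide_left_mono) auto
        ultimately show ?thesis by simp
      qed
      moreover have "\<rho> + s \<le> ?b" using \<rho> s v by simp
      moreover have pos: "\<rho> + s > 0" using \<rho> s by simp
      ultimately have "(\<rho> + s) powr (- lam0) \<le> ?b powr \<bar>lam0\<bar>"
      proof (cases "lam0 \<ge> 0")
        case True
        have "(\<rho> + s) powr (- lam0) = (1 / (\<rho> + s)) powr lam0"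
          using pos by (simp add: powr_divide powr_minus_divide)
        also have "\<dots> \<le> ?b powr lam0" using True pos \<open>1 / (\<rho> + s) \<le> ?b\<close> by (intro powr_mono2) auto
        finally show ?thesis using True by simp
      next
        case False
        then show ?thesis using pos \<open>\<rho> + s \<le> ?b\<close> by (auto intro!: powr_mono2)
      qed
      also have "\<dots> \<le> K3 * exp (1 / (2 * \<mu>) * v)" using v by (intro K3) auto
      finally have "\<rho> powr lam0 * (\<rho> + s) powr (- lam0) \<le> \<rho> powr lam0 * (K3 * exp (1 / (2 * \<mu>) * v))"
        by (intro mult_left_mono) auto
      moreover have "(1 + s / \<rho>) powr (- lam0) = \<rho> powr lam0 * (\<rho> + s) powr (- lam0)"
      proof -
        have "1 + s / \<rho> = (\<rho> + s) / \<rho>" using \<rho> by (simp add: field_simps)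
        then show ?thesis by (simp add: powr_divide powr_minus field_simps)
      qed
      ultimately show ?thesis by simp
    qed
    have k: "norm (1 / \<phi>\<^sub>k (e * s / \<rho>)) \<le> K2 * ((1 + s / \<rho>) powr (- lam0) * exp ((s / \<rho>) powr lam / \<mu>))"
      using K2(2)[of "e * s / \<rho>"] e s \<rho> by (simp add: abs_mult)
    have "norm (\<phi>\<^sub>w s / \<phi>\<^sub>k (e * s / \<rho>)) = norm (\<phi>\<^sub>w s) * norm (1 / \<phi>\<^sub>k (e * s / \<rho>))"
      by (simp add: norm_divide)
    also have "\<dots> \<le> (K1 * (\<rho> powr (lam * \<alpha>) * v powr \<alpha>)) *
        (K2 * ((\<rho> powr lam0 * (K3 * exp (1 / (2 * \<mu>) * v))) * (exp (1 / (\<mu> * m)) * exp (- (v / \<mu>)))))"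
      using K1 K2 K3 by (intro mult_mono w order.trans[OF k] mult_left_mono exp_le pow_le) auto
    also have "\<dots> = \<rho> powr (lam * \<alpha> + lam0) * exp (1 / (\<mu> * m)) *
        (K1 * K2 * K3 * (v powr \<alpha> * (exp (1 / (2 * \<mu>) * v) * exp (- (v / \<mu>)))))"
      by (simp add: powr_add mult_ac)
    also have "exp (1 / (2 * \<mu>) * v) * exp (- (v / \<mu>)) = exp (- (1 / (2 * \<mu>) * v))"
      using \<mu> by (simp add: field_simps flip: exp_add)
    finally show "norm (\<phi>\<^sub>w (1 - \<rho> powr lam * v) / \<phi>\<^sub>k (e * (1 - \<rho> powr lam * v) / \<rho>))
     \<le> \<rho> powr (lam * \<alpha> + lam0) * exp (1 / (\<mu> * \<rho> powr lam)) * (K1 * K2 * K3 * (v powr \<alpha> * exp (- (1 / (2 * \<mu>) * v))))"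
      by (simp only: s_def m_def)
  qed (use K1 K2 K3 in auto)
qed

text \<open>The quotient is a product of three convergent factors:
  \<open>\<phi>\<^sub>w (s n)\<close> over its leading power tends to A, the tail over
  \<open>\<phi>\<^sub>k\<close> tends to 1 / C along \<open>y n\<close>, and an explicit remainder
  tends to exp (-lam v / \<mu>).\<close>

lemma edge_weight_limit:
  assumes \<rho>: "\<rho> \<longlonglongrightarrow> 0" "\<And>n. \<rho> n > 0" and v: "v > 0" and e: "\<bar>e\<bar> = 1"
  shows "(\<lambda>n. \<phi>\<^sub>w (1 - \<rho> n powr lam * v) / \<phi>\<^sub>k (e * (1 - \<rho> n powr lam * v) / \<rho> n)
        / complex_of_real (\<rho> n powr (lam * \<alpha> + lam0) * exp (1 / (\<mu> * \<rho> n powr lam))))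
     \<longlonglongrightarrow> complex_of_real (A / C * (v powr \<alpha> * exp (- (lam / \<mu> * v))))"
proof -
  define m where "m n = \<rho> n powr lam" for n
  define s where "s n = 1 - m n * v" for n
  define y where "y n = e * s n / \<rho> n" for n
  have m: "m n > 0" for n using \<rho> by (simp add: m_def order_less_imp_not_eq2)
  have m_lim: "m \<longlonglongrightarrow> 0"
    unfolding m_def[abs_def] using lam \<rho> by (intro tendsto_zero_powrI[of _ _ _ lam]) (auto intro: always_eventually less_imp_le)
  have s_lim: "s \<longlonglongrightarrow> 1"
    unfolding s_def[abs_def] using m_lim by (auto intro!: tendsto_eq_intros)
  have s_pos: "\<forall>\<^sub>F n in sequentially. s n > 0"
    using s_lim by (rule order_tendstoD) simp
  have y_lim: "filterlim y at_infinity sequentially"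
  proof -
    have "filterlim \<rho> (at 0) sequentially"
      using \<rho> by (auto simp: filterlim_at less_imp_neq[symmetric])
    then have "filterlim (\<lambda>n. inverse (\<rho> n)) at_infinity sequentially"
      by (rule filterlim_compose[OF filterlim_inverse_at_infinity])
    then have "filterlim (\<lambda>n. e * s n * inverse (\<rho> n)) at_infinity sequentially"
      using e by (intro tendsto_mult_filterlim_at_infinity[of _ "e * 1"] tendsto_intros s_lim) auto
    then show ?thesis by (simp add: y_def[abs_def] divide_inverse)
  qed
  have k_lim: "(\<lambda>n. complex_of_real (\<bar>y n\<bar> powr lam0 * exp (- (\<bar>y n\<bar> powr lam) / \<mu>)) / \<phi>\<^sub>k (y n)) \<longlonglongrightarrow> 1 / C"
    by (rule filterlim_compose[OF cf_tail_ratio y_lim])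
  have w_lim: "(\<lambda>n. \<phi>\<^sub>w (s n) / complex_of_real ((m n * v) powr \<alpha>)) \<longlonglongrightarrow> A"
  proof -
    have "((\<lambda>t. (\<phi>\<^sub>w (1 - t) - complex_of_real (A * t powr \<alpha>)) / complex_of_real (t powr \<alpha>)) \<longlongrightarrow> 0) (at_right 0)"
      by (rule smalloD_tendsto[OF w_edge])
    moreover have "filterlim (\<lambda>n. m n * v) (at_right 0) sequentially"
      using m v m_lim
      by (auto simp: filterlim_at less_imp_neq[symmetric] intro!: tendsto_mult_left_zero always_eventually)
    ultimately have "(\<lambda>n. (\<phi>\<^sub>w (1 - m n * v) - complex_of_real (A * (m n * v) powr \<alpha>)) / complex_of_real ((m n * v) powr \<alpha>)) \<longlonglongrightarrow> 0"
      by (rule filterlim_compose)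
    then have "(\<lambda>n. (\<phi>\<^sub>w (1 - m n * v) - complex_of_real (A * (m n * v) powr \<alpha>)) / complex_of_real ((m n * v) powr \<alpha>) + A) \<longlonglongrightarrow> 0 + complex_of_real A"
      by (intro tendsto_intros)
    moreover have "(\<phi>\<^sub>w (1 - m n * v) - complex_of_real (A * (m n * v) powr \<alpha>)) / complex_of_real ((m n * v) powr \<alpha>) + A
        = \<phi>\<^sub>w (s n) / complex_of_real ((m n * v) powr \<alpha>)" for n
      using m[of n] v by (simp add: s_def diff_divide_distrib)
    ultimately show ?thesis by simp
  qed
  have "(\<lambda>n. s n powr (- lam0) * exp (- ((1 - s n powr lam) / m n / \<mu>))) \<longlonglongrightarrow> 1 powr (- lam0) * exp (- (lam * v / \<mu>))"
    unfolding s_def using \<mu>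
    by (intro tendsto_intros tendsto_edge_rate m m_lim v lam s_lim[unfolded s_def]) auto
  then have r_lim: "(\<lambda>n. complex_of_real (s n powr (- lam0) * exp (- ((1 - s n powr lam) / m n / \<mu>)))) \<longlonglongrightarrow> complex_of_real (exp (- (lam * v / \<mu>)))"
    by (intro tendsto_of_real) simp
  have "(\<lambda>n. complex_of_real (v powr \<alpha>) * (\<phi>\<^sub>w (s n) / complex_of_real ((m n * v) powr \<alpha>)) *
      (complex_of_real (\<bar>y n\<bar> powr lam0 * exp (- (\<bar>y n\<bar> powr lam) / \<mu>)) / \<phi>\<^sub>k (y n)) *
      complex_of_real (s n powr (- lam0) * exp (- ((1 - s n powr lam) / m n / \<mu>))))
      \<longlonglongrightarrow> complex_of_real (v powr \<alpha>) * A * (1 / C) * complex_of_real (exp (- (lam * v / \<mu>)))"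
    by (intro tendsto_mult tendsto_const w_lim k_lim r_lim)
  then show ?thesis
  proof (rule Lim_transform_eventually[THEN tendsto_eq_rhs])
    show "\<forall>\<^sub>F n in sequentially. complex_of_real (v powr \<alpha>) * (\<phi>\<^sub>w (s n) / complex_of_real ((m n * v) powr \<alpha>)) *
      (complex_of_real (\<bar>y n\<bar> powr lam0 * exp (- (\<bar>y n\<bar> powr lam) / \<mu>)) / \<phi>\<^sub>k (y n)) *
      complex_of_real (s n powr (- lam0) * exp (- ((1 - s n powr lam) / m n / \<mu>)))
      = \<phi>\<^sub>w (1 - \<rho> n powr lam * v) / \<phi>\<^sub>k (e * (1 - \<rho> n powr lam * v) / \<rho> n)
        / complex_of_real (\<rho> n powr (lam * \<alpha> + lam0) * exp (1 / (\<mu> * \<rho> n powr lam)))"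
      using s_pos
    proof eventually_elim
      case (elim n)
      have y: "\<bar>y n\<bar> = s n / \<rho> n" using e elim \<rho>(2)[of n] by (simp add: y_def abs_mult)
      \<comment> \<open>The normalisations inserted into the three factors recombine exactly to the
        reciprocal of the gauge. Positivity of \<open>s n\<close> removes the absolute value in
        \<open>y n\<close> and lets the powers of \<open>s n\<close> cancel.\<close>
      have r: "v powr \<alpha> / (m n * v) powr \<alpha> * (\<bar>y n\<bar> powr lam0 * exp (- (\<bar>y n\<bar> powr lam) / \<mu>)) *
          (s n powr (- lam0) * exp (- ((1 - s n powr lam) / m n / \<mu>)))
        = 1 / (\<rho> n powr (lam * \<alpha> + lam0) * exp (1 / (\<mu> * \<rho> n powr lam)))"
      proof -
        have "exp (- (\<bar>y n\<bar> powr lam) / \<mu>) * exp (- ((1 - s n powr lam) / m n / \<mu>)) = 1 / exp (1 / (\<mu> * m n))"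
          using m[of n] \<mu> unfolding y
          by (simp add: powr_divide m_def field_simps flip: exp_add exp_minus)
        moreover have "v powr \<alpha> / (m n * v) powr \<alpha> * (\<bar>y n\<bar> powr lam0 * s n powr (- lam0)) = 1 / \<rho> n powr (lam * \<alpha> + lam0)"
          using elim \<rho>(2)[of n] v unfolding y
          by (simp add: powr_divide powr_mult m_def powr_powr powr_add powr_minus field_simps)
        ultimately show ?thesis by (simp add: m_def mult_ac) (metis (no_types, lifting) divide_divide_eq_left mult.assoc mult.commute times_divide_eq_left mult_1)
      qed
      have "complex_of_real (v powr \<alpha>) * (\<phi>\<^sub>w (s n) / complex_of_real ((m n * v) powr \<alpha>)) *
          (complex_of_real (\<bar>y n\<bar> powr lam0 * exp (- (\<bar>y n\<bar> powr lam) / \<mu>)) / \<phi>\<^sub>k (y n)) *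
          complex_of_real (s n powr (- lam0) * exp (- ((1 - s n powr lam) / m n / \<mu>)))
        = \<phi>\<^sub>w (s n) / \<phi>\<^sub>k (y n) * complex_of_real (v powr \<alpha> / (m n * v) powr \<alpha> *
          (\<bar>y n\<bar> powr lam0 * exp (- (\<bar>y n\<bar> powr lam) / \<mu>)) *
          (s n powr (- lam0) * exp (- ((1 - s n powr lam) / m n / \<mu>))))"
        by (simp add: mult_ac)
      then show ?case
        unfolding r by (simp add: s_def m_def y_def)
    qed
    show "complex_of_real (v powr \<alpha>) * A * (1 / C) * complex_of_real (exp (- (lam * v / \<mu>)))
       = complex_of_real (A / C * (v powr \<alpha> * exp (- (lam / \<mu> * v))))"
      by simp
  qed
qed

text \<open>Order of magnitude of the integrand at the edge scale: \<rho>^(lam \<alpha>) comes from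
  \<open>\<phi>\<^sub>w\<close>, the rest from 1 / \<open>\<phi>\<^sub>k\<close> at 1 / \<rho>. The
  further factor \<rho>^lam of the full normalisation is the Jacobian of s = 1 - \<rho>^lam v and is
  kept apart.\<close>

definition edge_gauge :: "real \<Rightarrow> real" where
  "edge_gauge \<rho> = \<rho> powr (lam * \<alpha> + lam0) * exp (1 / (\<mu> * \<rho> powr lam))"

definition edge_weight :: "real \<Rightarrow> real \<Rightarrow> real \<Rightarrow> complex" where
  "edge_weight e \<rho> v = indicator {0<..<1} (1 - \<rho> powr lam * v) *\<^sub>R
     (\<phi>\<^sub>w (1 - \<rho> powr lam * v) / \<phi>\<^sub>k (e * (1 - \<rho> powr lam * v) / \<rho>) / complex_of_real (edge_gauge \<rho>))"

text \<open>For \<open>e = -1\<close> this is the integral over (-1, 0) reflected to (0, 1), with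
  the evenness of \<open>\<phi>\<^sub>w\<close> already built in. Both signs thus see the edge at 1
  and differ only in the arguments of \<open>\<phi>\<^sub>k\<close> and of the exponential.\<close>

definition half_integral :: "real \<Rightarrow> real \<Rightarrow> real \<Rightarrow> complex" where
  "half_integral e \<rho> u =
     (CLINT s|lborel. indicator {0<..<1} s *\<^sub>R (\<phi>\<^sub>w s / \<phi>\<^sub>k (e * s / \<rho>) * iexp (e * u * s)))"

text \<open>A / C times the integral of v^\<alpha> exp (-lam v / \<mu>) over the positive half-line.
  It is the common limit of the integrals of \<open>edge_weight\<close> at both edges.\<close>

definition edge_const :: real where
  "edge_const = A / C * (Gamma (\<alpha> + 1) / (lam / \<mu>) powr (\<alpha> + 1))"

lemma k_meas [measurable]: "\<phi>\<^sub>k \<in> borel_measurable borel"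
  by (rule borel_measurable_continuous_onI[OF k_cont])

lemmas [measurable] = w_meas

lemma edge_gauge_pos: "\<rho> > 0 \<Longrightarrow> edge_gauge \<rho> > 0"
  by (simp add: edge_gauge_def order_less_imp_not_eq2)

lemma edge_weight_measurable [measurable]: "edge_weight e \<rho> \<in> borel_measurable borel"
  unfolding edge_weight_def[abs_def] by measurable

lemma norm_edge_weight_le:
  "\<exists>K>0. \<forall>\<rho> v e. 0 < \<rho> \<longrightarrow> \<rho> \<le> 1 \<longrightarrow> \<bar>e\<bar> = 1 \<longrightarrow>
     norm (edge_weight e \<rho> v) \<le> K * (indicator {0<..} v * (v powr \<alpha> * exp (- (1 / (2 * \<mu>) * v))))"
proof -
  obtain K where K: "K > 0" "\<And>\<rho> v e. 0 < \<rho> \<Longrightarrow> \<rho> \<le> 1 \<Longrightarrow> 0 < v \<Longrightarrow> \<rho> powr lam * v \<le> 1 \<Longrightarrow> \<bar>e\<bar> = 1 \<Longrightarrow>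
     norm (\<phi>\<^sub>w (1 - \<rho> powr lam * v) / \<phi>\<^sub>k (e * (1 - \<rho> powr lam * v) / \<rho>))
     \<le> edge_gauge \<rho> * (K * (v powr \<alpha> * exp (- (1 / (2 * \<mu>) * v))))"
    using edge_weight_bound unfolding edge_gauge_def by blast
  show ?thesis
  proof (intro exI[of _ K] conjI allI impI K(1))
    fix \<rho> v e :: real assume \<rho>: "0 < \<rho>" "\<rho> \<le> 1" and e: "\<bar>e\<bar> = 1"
    show "norm (edge_weight e \<rho> v) \<le> K * (indicator {0<..} v * (v powr \<alpha> * exp (- (1 / (2 * \<mu>) * v))))"
    proof (cases "0 < v \<and> \<rho> powr lam * v < 1")
      case True
      then have "norm (edge_weight e \<rho> v) = norm (\<phi>\<^sub>w (1 - \<rho> powr lam * v) / \<phi>\<^sub>k (e * (1 - \<rho> powr lam * v) / \<rho>)) / edge_gauge \<rho>"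
        using \<rho> edge_gauge_pos[OF \<rho>(1)] by (simp add: edge_weight_def norm_divide norm_mult)
      also have "\<dots> \<le> K * (v powr \<alpha> * exp (- (1 / (2 * \<mu>) * v)))"
        using K(2)[OF \<rho> _ _ e, of v] True edge_gauge_pos[OF \<rho>(1)] by (simp add: divide_le_eq mult.commute)
      finally show ?thesis using True by simp
    next
      case False
      then have "1 - \<rho> powr lam * v \<notin> {0<..<1}" using \<rho> by (auto simp: zero_less_mult_iff)
      then have "edge_weight e \<rho> v = 0" by (simp add: edge_weight_def)
      then show ?thesis using K(1) by (simp add: indicator_def)
    qed
  qed
qed

lemma edge_weight_tendsto:
  assumes \<rho>: "\<rho> \<longlonglongrightarrow> 0" "\<And>n. \<rho> n > 0" and e: "\<bar>e\<bar> = 1"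
  shows "(\<lambda>n. edge_weight e (\<rho> n) v) \<longlonglongrightarrow>
    complex_of_real (A / C * (indicator {0<..} v * (v powr \<alpha> * exp (- (lam / \<mu> * v)))))"
proof (cases "v > 0")
  case True
  have "(\<lambda>n. \<rho> n powr lam * v) \<longlonglongrightarrow> 0"
    using lam \<rho> by (intro tendsto_mult_left_zero tendsto_zero_powrI[of _ _ _ lam]) (auto intro: always_eventually less_imp_le)
  then have "\<forall>\<^sub>F n in sequentially. \<rho> n powr lam * v < 1"
    by (rule order_tendstoD) simp
  then have "\<forall>\<^sub>F n in sequentially. \<phi>\<^sub>w (1 - \<rho> n powr lam * v) / \<phi>\<^sub>k (e * (1 - \<rho> n powr lam * v) / \<rho> n)
        / complex_of_real (\<rho> n powr (lam * \<alpha> + lam0) * exp (1 / (\<mu> * \<rho> n powr lam))) = edge_weight e (\<rho> n) v"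
  proof eventually_elim
    case (elim n)
    then have "1 - \<rho> n powr lam * v \<in> {0<..<1}" using True \<rho>(2)[of n] by auto
    then show ?case by (simp add: edge_weight_def edge_gauge_def)
  qed
  then show ?thesis
    using Lim_transform_eventually[OF edge_weight_limit[OF \<rho> True e]] True by simp
next
  case False
  then have "edge_weight e (\<rho> n) v = 0" for n
    using \<rho>(2)[of n] by (auto simp: edge_weight_def indicator_def zero_less_mult_iff)
  then show ?thesis using False by simp
qed

lemma integral_edge_weight_tendsto:
  assumes \<rho>: "\<rho> \<longlonglongrightarrow> 0" "\<And>n. \<rho> n > 0" and e: "\<bar>e\<bar> = 1"
  shows "(\<lambda>n. CLINT v|lborel. edge_weight e (\<rho> n) v) \<longlonglongrightarrow> complex_of_real edge_const"
proof -
  obtain K where K: "\<And>\<rho> v e. 0 < \<rho> \<Longrightarrow> \<rho> \<le> 1 \<Longrightarrow> \<bar>e\<bar> = 1 \<Longrightarrow>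
     norm (edge_weight e \<rho> v) \<le> K * (indicator {0<..} v * (v powr \<alpha> * exp (- (1 / (2 * \<mu>) * v))))"
    using norm_edge_weight_le by blast
  \<comment> \<open>The domination holds for \<rho> \<le> 1 only, whereas the dominated convergence
    theorem asks for it at every index. Truncation repairs this and changes only finitely many
    terms.\<close>
  define r where "r n = min (\<rho> n) 1" for n
  have r: "r n > 0" "r n \<le> 1" for n using \<rho>(2)[of n] by (auto simp: r_def)
  have "r \<longlonglongrightarrow> min 0 1" unfolding r_def[abs_def] by (intro tendsto_min \<rho> tendsto_const)
  then have r0: "r \<longlonglongrightarrow> 0" by simp
  have G: "has_bochner_integral lborel (\<lambda>v. indicator {0<..} v * (v powr \<alpha> * exp (- (lam / \<mu> * v))))
      (Gamma (\<alpha> + 1) / (lam / \<mu>) powr (\<alpha> + 1))"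
    using lam \<mu> \<alpha> by (intro has_bochner_integral_Gamma) auto
  have "(\<lambda>n. CLINT v|lborel. edge_weight e (r n) v) \<longlonglongrightarrow>
     (CLINT v|lborel. complex_of_real (A / C * (indicator {0<..} v * (v powr \<alpha> * exp (- (lam / \<mu> * v))))))"
  proof (rule integral_dominated_convergence)
    show "integrable lborel (\<lambda>v. K * (indicator {0<..} v * (v powr \<alpha> * exp (- (1 / (2 * \<mu>) * v)))))"
      using has_bochner_integral_Gamma[of \<alpha> "1 / (2 * \<mu>)"] \<alpha> \<mu>
      by (intro integrable_mult_right) (auto simp: has_bochner_integral_iff)
  qed (use K r e edge_weight_tendsto[OF r0 r(1) e] in auto)
  also have "(CLINT v|lborel. complex_of_real (A / C * (indicator {0<..} v * (v powr \<alpha> * exp (- (lam / \<mu> * v))))))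
      = edge_const"
    unfolding integral_complex_of_real edge_const_def
    by (subst integral_mult_right_zero) (simp only: has_bochner_integral_integral_eq[OF G])
  finally show ?thesis
  proof (rule Lim_transform_eventually)
    have "\<forall>\<^sub>F n in sequentially. \<rho> n < 1" using \<rho>(1) by (rule order_tendstoD) simp
    then show "\<forall>\<^sub>F n in sequentially. (CLINT v|lborel. edge_weight e (r n) v) = (CLINT v|lborel. edge_weight e (\<rho> n) v)"
      by eventually_elim (simp add: r_def)
  qed
qed

section \<open>From the integrand to the whole inversion integral\<close>

lemma half_integral_eq:
  assumes \<rho>: "\<rho> > 0"
  shows "half_integral e \<rho> u = complex_of_real (\<rho> powr lam * edge_gauge \<rho>) *
    (CLINT v|lborel. edge_weight e \<rho> v * iexp (e * u * (1 - \<rho> powr lam * v)))"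
proof -
  define m where "m = \<rho> powr lam"
  have m: "m > 0" using \<rho> by (simp add: m_def)
  let ?F = "\<lambda>s. indicator {0<..<1} s *\<^sub>R (\<phi>\<^sub>w s / \<phi>\<^sub>k (e * s / \<rho>) * iexp (e * u * s))"
  have "half_integral e \<rho> u = \<bar>- m\<bar> *\<^sub>R (CLINT v|lborel. ?F (1 + - m * v))"
    unfolding half_integral_def using m by (intro lborel_integral_real_affine) auto
  also have "\<dots> = complex_of_real m * (CLINT v|lborel. complex_of_real (edge_gauge \<rho>) *
      (edge_weight e \<rho> v * iexp (e * u * (1 - m * v))))"
    using m edge_gauge_pos[OF \<rho>]
    by (auto simp: edge_weight_def m_def[symmetric] scaleR_conv_of_real intro!: Bochner_Integration.integral_cong)
  finally show ?thesis by (simp add: m_def)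
qed

text \<open>The first bound is free of \<open>u\<close> because the oscillating factor has modulus
  1. For the second, replacing that factor by its value at v = 0 costs at most |u| \<rho>^lam v by
  the Lipschitz bound, and what remains is the error of the non-oscillating integral, which does not
  involve \<open>u\<close>.\<close>

lemma half_integral_estimates:
  "\<exists>K>0. \<forall>\<rho> u e. 0 < \<rho> \<longrightarrow> \<rho> \<le> 1 \<longrightarrow> \<bar>e\<bar> = 1 \<longrightarrow>
     norm (half_integral e \<rho> u / (\<rho> powr lam * edge_gauge \<rho>)) \<le> K \<and>
     norm (half_integral e \<rho> u / (\<rho> powr lam * edge_gauge \<rho>) - edge_const * iexp (e * u))
       \<le> norm ((CLINT v|lborel. edge_weight e \<rho> v) - edge_const) + K * \<bar>u\<bar> * \<rho> powr lam"
proof -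
  obtain K where K: "K > 0" "\<And>\<rho> v e. 0 < \<rho> \<Longrightarrow> \<rho> \<le> 1 \<Longrightarrow> \<bar>e\<bar> = 1 \<Longrightarrow>
     norm (edge_weight e \<rho> v) \<le> K * (indicator {0<..} v * (v powr \<alpha> * exp (- (1 / (2 * \<mu>) * v))))"
    using norm_edge_weight_le by blast
  define G1 where "G1 = Gamma (\<alpha> + 1) / (1 / (2 * \<mu>)) powr (\<alpha> + 1)"
  \<comment> \<open>The exponent is raised by one to absorb the extra factor v of the Lipschitz
    bound.\<close>
  define G2 where "G2 = Gamma (\<alpha> + 1 + 1) / (1 / (2 * \<mu>)) powr (\<alpha> + 1 + 1)"
  have G: "G1 > 0" "G2 > 0"
    using \<alpha> \<mu> by (auto simp: G1_def G2_def intro!: divide_pos_pos Gamma_real_pos)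
  have G1: "has_bochner_integral lborel (\<lambda>v. indicator {0<..} v * (v powr \<alpha> * exp (- (1 / (2 * \<mu>) * v)))) G1"
    unfolding G1_def using \<alpha> \<mu> by (intro has_bochner_integral_Gamma) auto
  have G2: "has_bochner_integral lborel (\<lambda>v. indicator {0<..} v * (v powr (\<alpha> + 1) * exp (- (1 / (2 * \<mu>) * v)))) G2"
    unfolding G2_def using \<alpha> \<mu> by (intro has_bochner_integral_Gamma) auto
  show ?thesis
  proof (intro exI[of _ "K * G1 + K * G2"] conjI allI impI)
    fix \<rho> u e :: real assume \<rho>: "0 < \<rho>" "\<rho> \<le> 1" and e: "\<bar>e\<bar> = 1"
    define m where "m = \<rho> powr lam"
    have m: "m > 0" using \<rho> by (simp add: m_def)
    have pos: "complex_of_real m * complex_of_real (edge_gauge \<rho>) \<noteq> 0"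
      using \<rho> m edge_gauge_pos[OF \<rho>(1)] by simp
    let ?I = "half_integral e \<rho> u / (\<rho> powr lam * edge_gauge \<rho>)"
    have I_eq: "?I = (CLINT v|lborel. edge_weight e \<rho> v * iexp (e * u * (1 - m * v)))"
      using pos \<rho> by (simp add: half_integral_eq m_def)
    note bd = K(2)[OF \<rho> e]
    have intK: "integrable lborel (\<lambda>v. K * (indicator {0<..} v * (v powr \<alpha> * exp (- (1 / (2 * \<mu>) * v)))))"
      using G1 by (intro integrable_mult_right) (auto simp: has_bochner_integral_iff)
    have i0: "complex_integrable lborel (edge_weight e \<rho>)"
      by (rule Bochner_Integration.integrable_bound[OF intK])
        (auto intro!: AE_I2 order.trans[OF bd])
    have i1: "complex_integrable lborel (\<lambda>v. edge_weight e \<rho> v * iexp (e * u * (1 - m * v)))"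
      by (rule Bochner_Integration.integrable_bound[OF i0]) (auto simp: norm_mult)
    have "norm ?I \<le> (\<integral>v. K * (indicator {0<..} v * (v powr \<alpha> * exp (- (1 / (2 * \<mu>) * v)))) \<partial>lborel)"
      unfolding I_eq
      by (rule Bochner_Integration.integral_norm_bound_integral[OF i1 intK]) (use bd in \<open>simp add: norm_mult\<close>)
    also have "\<dots> = K * G1"
      by (subst integral_mult_right_zero) (simp only: has_bochner_integral_integral_eq[OF G1])
    also have "\<dots> \<le> K * G1 + K * G2" using K G by simp
    finally show "norm ?I \<le> K * G1 + K * G2" .
    have eq: "edge_weight e \<rho> v * (iexp (e * u * (1 - m * v)) - iexp (e * u))
        = edge_weight e \<rho> v * iexp (e * u * (1 - m * v)) - edge_weight e \<rho> v * iexp (e * u)" for v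
      by (rule right_diff_distrib)
    define X where "X = (CLINT v|lborel. edge_weight e \<rho> v * (iexp (e * u * (1 - m * v)) - iexp (e * u)))"
    have X_eq: "X = ?I - (CLINT v|lborel. edge_weight e \<rho> v) * iexp (e * u)"
      unfolding X_def I_eq eq using i0 by (subst Bochner_Integration.integral_diff[OF i1]) auto
    have "?I - edge_const * iexp (e * u) = X + iexp (e * u) * ((CLINT v|lborel. edge_weight e \<rho> v) - edge_const)"
      unfolding X_eq by (simp only: right_diff_distrib) (simp add: mult.commute)
    then have "norm (?I - edge_const * iexp (e * u)) \<le> norm X + norm ((CLINT v|lborel. edge_weight e \<rho> v) - edge_const)"
      using norm_triangle_ineq[of X "iexp (e * u) * ((CLINT v|lborel. edge_weight e \<rho> v) - edge_const)"]
      by (simp add: norm_mult)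
    moreover have "norm X
       \<le> (\<integral>v. K * \<bar>u\<bar> * m * (indicator {0<..} v * (v powr (\<alpha> + 1) * exp (- (1 / (2 * \<mu>) * v)))) \<partial>lborel)"
      unfolding X_def
    proof (rule Bochner_Integration.integral_norm_bound_integral)
      show "complex_integrable lborel (\<lambda>v. edge_weight e \<rho> v * (iexp (e * u * (1 - m * v)) - iexp (e * u)))"
        unfolding eq using i0 by (intro Bochner_Integration.integrable_diff i1) auto
      show "integrable lborel (\<lambda>v. K * \<bar>u\<bar> * m * (indicator {0<..} v * (v powr (\<alpha> + 1) * exp (- (1 / (2 * \<mu>) * v)))))"
        using G2 by (intro integrable_mult_right) (auto simp: has_bochner_integral_iff)
      fix v :: real
      have "norm (edge_weight e \<rho> v * (iexp (e * u * (1 - m * v)) - iexp (e * u)))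
        \<le> K * (indicator {0<..} v * (v powr \<alpha> * exp (- (1 / (2 * \<mu>) * v)))) * \<bar>e * u * (1 - m * v) - e * u\<bar>"
        unfolding norm_mult by (intro mult_mono bd norm_iexp_diff_le) (use K in auto)
      also have "\<bar>e * u * (1 - m * v) - e * u\<bar> = \<bar>u\<bar> * m * \<bar>v\<bar>"
        using e m by (simp add: algebra_simps abs_mult)
      also have "K * (indicator {0<..} v * (v powr \<alpha> * exp (- (1 / (2 * \<mu>) * v)))) * (\<bar>u\<bar> * m * \<bar>v\<bar>)
        = K * \<bar>u\<bar> * m * (indicator {0<..} v * (v powr (\<alpha> + 1) * exp (- (1 / (2 * \<mu>) * v))))"
        by (auto simp: indicator_def powr_add)
      finally show "norm (edge_weight e \<rho> v * (iexp (e * u * (1 - m * v)) - iexp (e * u)))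
        \<le> K * \<bar>u\<bar> * m * (indicator {0<..} v * (v powr (\<alpha> + 1) * exp (- (1 / (2 * \<mu>) * v))))" .
    qed
    moreover have "\<dots> = K * \<bar>u\<bar> * m * G2"
      by (subst integral_mult_right_zero) (simp only: has_bochner_integral_integral_eq[OF G2])
    moreover have "K * \<bar>u\<bar> * m * G2 \<le> (K * G1 + K * G2) * \<bar>u\<bar> * m"
      using K G m by (simp add: algebra_simps)
    ultimately show "norm (?I - edge_const * iexp (e * u))
       \<le> norm ((CLINT v|lborel. edge_weight e \<rho> v) - edge_const) + (K * G1 + K * G2) * \<bar>u\<bar> * \<rho> powr lam"
      unfolding m_def by linarith
  qed (use K G in \<open>simp add: add_pos_pos\<close>)
qed

text \<open>\<open>\<phi>\<^sub>w\<close> is bounded and lives on [-1, 1], and on this compact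
  interval the reciprocal of the continuous zero-free denominator is bounded.\<close>

lemma integrable_ft_ratio:
  assumes \<rho>: "\<rho> > 0"
  shows "complex_integrable lborel (\<lambda>s. \<phi>\<^sub>w s / \<phi>\<^sub>k (s / \<rho>))"
proof -
  have "continuous_on {-1..1} (\<lambda>s. inverse (\<phi>\<^sub>k (s / \<rho>)))"
    using \<rho> k_nz by (intro continuous_intros continuous_on_compose2[OF k_cont]) auto
  then have "bounded ((\<lambda>s. inverse (\<phi>\<^sub>k (s / \<rho>))) ` {-1..1})"
    by (intro compact_imp_bounded compact_continuous_image) auto
  then obtain B where "\<forall>z\<in>(\<lambda>s. inverse (\<phi>\<^sub>k (s / \<rho>))) ` {-1..1}. norm z \<le> B"
    unfolding bounded_iff by blast
  then have B: "norm (inverse (\<phi>\<^sub>k (s / \<rho>))) \<le> B" if "s \<in> {-1..1}" for s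
    using that by blast
  show ?thesis
  proof (rule Bochner_Integration.integrable_bound)
    show "integrable lborel (\<lambda>s. B * indicator {-1..1::real} s)" by simp
    have "norm (\<phi>\<^sub>w s / \<phi>\<^sub>k (s / \<rho>)) \<le> norm (B * indicator {-1..1::real} s)" for s
    proof (cases "s \<in> {-1..1}")
      case True
      have "norm (\<phi>\<^sub>w s) * norm (inverse (\<phi>\<^sub>k (s / \<rho>))) \<le> 1 * B"
        using w_le B[OF True] by (intro mult_mono) auto
      then show ?thesis using True by (simp add: divide_inverse norm_mult)
    qed (simp add: w_supp)
    then show "AE s in lborel. norm (\<phi>\<^sub>w s / \<phi>\<^sub>k (s / \<rho>)) \<le> norm (B * indicator {-1..1::real} s)" by simp
  qed simp
qed

text \<open>The line is cut at -1, 0 and 1, a null set on which the values of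
  \<open>\<phi>\<^sub>w\<close> are irrelevant for the integral, and the negative half is reflected.
  Almost everywhere evenness is enough because it is used under the integral sign.\<close>

lemma ft_ratio_integral_eq:
  assumes \<rho>: "\<rho> > 0"
  shows "(CLINT s|lborel. iexp (s * u) * (\<phi>\<^sub>w s / \<phi>\<^sub>k (s / \<rho>))) = half_integral 1 \<rho> u + half_integral (-1) \<rho> u"
proof -
  let ?F = "\<lambda>s. iexp (s * u) * (\<phi>\<^sub>w s / \<phi>\<^sub>k (s / \<rho>))"
  have int: "complex_integrable lborel ?F"
    by (intro integrable_iexp_mult integrable_ft_ratio \<rho>)
  have ind: "complex_integrable lborel (\<lambda>s. indicator S s *\<^sub>R ?F s)" if "S \<in> sets borel" for S
    using int that by (intro integrable_mult_indicator) auto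
  have neg: "half_integral (-1) \<rho> u = (CLINT s|lborel. indicator {-1<..<0} s *\<^sub>R ?F s)"
  proof -
    have "half_integral (-1) \<rho> u = (CLINT s|lborel. indicator {0<..<1} (- s) *\<^sub>R (\<phi>\<^sub>w (- s) / \<phi>\<^sub>k (s / \<rho>) * iexp (u * s)))"
      unfolding half_integral_def by (subst lborel_integral_real_affine[of "-1" _ 0]) auto
    also have "\<dots> = (CLINT s|lborel. indicator {-1<..<0} s *\<^sub>R ?F s)"
    proof (rule integral_cong_AE)
      show "AE s in lborel. indicator {0<..<1} (- s) *\<^sub>R (\<phi>\<^sub>w (- s) / \<phi>\<^sub>k (s / \<rho>) * iexp (u * s)) = indicator {-1<..<0} s *\<^sub>R ?F s"
        using w_even by eventually_elim (auto simp: indicator_def mult_ac)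
    qed auto
    finally show ?thesis .
  qed
  have "(CLINT s|lborel. ?F s) = (CLINT s|lborel. indicator {0<..<1} s *\<^sub>R ?F s + indicator {-1<..<0} s *\<^sub>R ?F s)"
  proof (rule integral_cong_AE)
    have "AE s in lborel. s \<noteq> (-1::real)" "AE s in lborel. s \<noteq> (0::real)" "AE s in lborel. s \<noteq> (1::real)"
      by (rule AE_lborel_singleton)+
    then show "AE s in lborel. ?F s = indicator {0<..<1} s *\<^sub>R ?F s + indicator {-1<..<0} s *\<^sub>R ?F s"
      by eventually_elim (auto simp: indicator_def w_supp)
  qed auto
  also have "\<dots> = (CLINT s|lborel. indicator {0<..<1} s *\<^sub>R ?F s) + (CLINT s|lborel. indicator {-1<..<0} s *\<^sub>R ?F s)"
    by (intro Bochner_Integration.integral_add ind) auto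
  also have "(CLINT s|lborel. indicator {0<..<1} s *\<^sub>R ?F s) = half_integral 1 \<rho> u"
    by (simp add: half_integral_def mult_ac)
  finally show ?thesis by (simp add: neg)
qed

text \<open>The sum of the contributions iexp(u) and iexp(-u) of the two edges is 2 cos u.
  Quantifying over \<open>u\<close> inside the eventuality is essential, since later
  \<open>u\<close> is the random (X - x)/h; accordingly \<epsilon>, the sum of the two
  non-oscillating errors, depends on n alone.\<close>

lemma ft_ratio_integral_edge:
  assumes \<rho>: "\<rho> \<longlonglongrightarrow> 0" "\<And>n. \<rho> n > 0"
  shows "\<exists>K>0. \<exists>\<epsilon>. \<epsilon> \<longlonglongrightarrow> 0 \<and> (\<forall>\<^sub>F n in sequentially. \<forall>u.
     norm ((CLINT s|lborel. iexp (s * u) * (\<phi>\<^sub>w s / \<phi>\<^sub>k (s / \<rho> n)))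
       / (\<rho> n powr (lam * (1 + \<alpha>) + lam0) * exp (1 / (\<mu> * \<rho> n powr lam)))) \<le> K \<and>
     norm ((CLINT s|lborel. iexp (s * u) * (\<phi>\<^sub>w s / \<phi>\<^sub>k (s / \<rho> n)))
       / (\<rho> n powr (lam * (1 + \<alpha>) + lam0) * exp (1 / (\<mu> * \<rho> n powr lam))) - 2 * edge_const * cos u)
       \<le> \<epsilon> n + K * \<bar>u\<bar> * \<rho> n powr lam)"
proof -
  obtain K where K: "K > 0" "\<And>\<rho> u e. 0 < \<rho> \<Longrightarrow> \<rho> \<le> 1 \<Longrightarrow> \<bar>e\<bar> = 1 \<Longrightarrow>
     norm (half_integral e \<rho> u / (\<rho> powr lam * edge_gauge \<rho>)) \<le> K \<and>
     norm (half_integral e \<rho> u / (\<rho> powr lam * edge_gauge \<rho>) - edge_const * iexp (e * u))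
       \<le> norm ((CLINT v|lborel. edge_weight e \<rho> v) - edge_const) + K * \<bar>u\<bar> * \<rho> powr lam"
    using half_integral_estimates by blast
  define d where "d e n = norm ((CLINT v|lborel. edge_weight e (\<rho> n) v) - edge_const)" for e n
  have d: "d e \<longlonglongrightarrow> 0" if "\<bar>e\<bar> = 1" for e
    unfolding d_def[abs_def]
    by (rule tendsto_norm_zero, rule Lim_null[THEN iffD1], rule integral_edge_weight_tendsto[OF \<rho> that])
  have gauge: "\<rho> n powr (lam * (1 + \<alpha>) + lam0) * exp (1 / (\<mu> * \<rho> n powr lam)) = \<rho> n powr lam * edge_gauge (\<rho> n)" for n
    by (simp add: edge_gauge_def powr_add ring_distribs)
  have ev: "\<forall>\<^sub>F n in sequentially. \<rho> n < 1" using \<rho>(1) by (rule order_tendstoD) simp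
  show ?thesis
  proof (intro exI[of _ "2 * K"] exI[of _ "\<lambda>n. d 1 n + d (-1) n"] conjI)
    show "(\<lambda>n. d 1 n + d (-1) n) \<longlonglongrightarrow> 0"
      using tendsto_add[OF d[of 1] d[of "-1"]] by simp
    show "\<forall>\<^sub>F n in sequentially. \<forall>u.
       norm ((CLINT s|lborel. iexp (s * u) * (\<phi>\<^sub>w s / \<phi>\<^sub>k (s / \<rho> n)))
         / (\<rho> n powr (lam * (1 + \<alpha>) + lam0) * exp (1 / (\<mu> * \<rho> n powr lam)))) \<le> 2 * K \<and>
       norm ((CLINT s|lborel. iexp (s * u) * (\<phi>\<^sub>w s / \<phi>\<^sub>k (s / \<rho> n)))
         / (\<rho> n powr (lam * (1 + \<alpha>) + lam0) * exp (1 / (\<mu> * \<rho> n powr lam))) - 2 * edge_const * cos u)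
         \<le> d 1 n + d (-1) n + 2 * K * \<bar>u\<bar> * \<rho> n powr lam"
      using ev
    proof (eventually_elim, intro allI)
      fix n u assume n: "\<rho> n < 1"
      let ?h = "\<lambda>e. half_integral e (\<rho> n) u / (\<rho> n powr lam * edge_gauge (\<rho> n))"
      note e1 = K(2)[OF \<rho>(2) less_imp_le[OF n], of 1 u] and e2 = K(2)[OF \<rho>(2) less_imp_le[OF n], of "-1" u]
      have split: "(CLINT s|lborel. iexp (s * u) * (\<phi>\<^sub>w s / \<phi>\<^sub>k (s / \<rho> n)))
         / (\<rho> n powr (lam * (1 + \<alpha>) + lam0) * exp (1 / (\<mu> * \<rho> n powr lam))) = ?h 1 + ?h (-1)"
        unfolding of_real_mult[symmetric] gauge ft_ratio_integral_eq[OF \<rho>(2)] by (rule add_divide_distrib)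
      have cos: "2 * edge_const * cos u = edge_const * iexp (1 * u) + edge_const * iexp (-1 * u)"
        by (simp add: complex_eq_iff Re_exp Im_exp)
      show "norm ((CLINT s|lborel. iexp (s * u) * (\<phi>\<^sub>w s / \<phi>\<^sub>k (s / \<rho> n)))
         / (\<rho> n powr (lam * (1 + \<alpha>) + lam0) * exp (1 / (\<mu> * \<rho> n powr lam)))) \<le> 2 * K \<and>
       norm ((CLINT s|lborel. iexp (s * u) * (\<phi>\<^sub>w s / \<phi>\<^sub>k (s / \<rho> n)))
         / (\<rho> n powr (lam * (1 + \<alpha>) + lam0) * exp (1 / (\<mu> * \<rho> n powr lam))) - 2 * edge_const * cos u)
         \<le> d 1 n + d (-1) n + 2 * K * \<bar>u\<bar> * \<rho> n powr lam"
      proof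
        show "norm ((CLINT s|lborel. iexp (s * u) * (\<phi>\<^sub>w s / \<phi>\<^sub>k (s / \<rho> n)))
         / (\<rho> n powr (lam * (1 + \<alpha>) + lam0) * exp (1 / (\<mu> * \<rho> n powr lam)))) \<le> 2 * K"
          unfolding split by (rule norm_triangle_le) (use e1 e2 in simp)
        show "norm ((CLINT s|lborel. iexp (s * u) * (\<phi>\<^sub>w s / \<phi>\<^sub>k (s / \<rho> n)))
         / (\<rho> n powr (lam * (1 + \<alpha>) + lam0) * exp (1 / (\<mu> * \<rho> n powr lam))) - 2 * edge_const * cos u)
         \<le> d 1 n + d (-1) n + 2 * K * \<bar>u\<bar> * \<rho> n powr lam"
          unfolding split cos add_diff_add
          by (rule norm_triangle_le) (use e1 e2 in \<open>simp add: d_def\<close>)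
      qed
    qed
  qed (use K in simp)
qed

end

section \<open>Decay of the noise transform, and the estimator as a sum of weights\<close>

context supersmooth_cf begin

lemma cf_tendsto_0: "(\<phi>\<^sub>k \<longlongrightarrow> 0) at_top"
proof -
  have "((\<lambda>y::real. y powr lam0 * exp (- (y powr lam) / \<mu>)) \<longlongrightarrow> 0) at_top"
    using lam \<mu> by real_asymp
  then have "((\<lambda>y. \<bar>y\<bar> powr lam0 * exp (- (\<bar>y\<bar> powr lam) / \<mu>)) \<longlongrightarrow> 0) at_top"
    by (rule Lim_transform_eventually) (use eventually_ge_at_top[of 0] in eventually_elim, simp)
  then have "((\<lambda>y. complex_of_real (C * (\<bar>y\<bar> powr lam0 * exp (- (\<bar>y\<bar> powr lam) / \<mu>)))) \<longlongrightarrow> complex_of_real (C * 0)) at_top"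
    by (intro tendsto_of_real tendsto_mult tendsto_const)
  moreover have "((\<lambda>t. \<phi>\<^sub>k t / complex_of_real (C * \<bar>t\<bar> powr lam0 * exp (- (\<bar>t\<bar> powr lam) / \<mu>))) \<longlongrightarrow> 1) at_top"
    by (rule tendsto_mono[OF _ cf_over_tail]) (rule at_top_le_at_infinity)
  ultimately have "((\<lambda>y. \<phi>\<^sub>k y / complex_of_real (C * \<bar>y\<bar> powr lam0 * exp (- (\<bar>y\<bar> powr lam) / \<mu>)) *
      complex_of_real (C * (\<bar>y\<bar> powr lam0 * exp (- (\<bar>y\<bar> powr lam) / \<mu>)))) \<longlongrightarrow> 1 * complex_of_real (C * 0)) at_top"
    by (intro tendsto_mult)
  then have "((\<lambda>y. \<phi>\<^sub>k y / complex_of_real (C * \<bar>y\<bar> powr lam0 * exp (- (\<bar>y\<bar> powr lam) / \<mu>)) *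
      complex_of_real (C * (\<bar>y\<bar> powr lam0 * exp (- (\<bar>y\<bar> powr lam) / \<mu>)))) \<longlongrightarrow> 0) at_top"
    by simp
  then show ?thesis
    \<comment> \<open>Quotient times tail gives back \<open>\<phi>\<^sub>k\<close> only where the
      tail is non-zero, hence the restriction to positive arguments.\<close>
    by (rule Lim_transform_eventually)
      (use eventually_gt_at_top[of 0] in eventually_elim, use cf_tail_const_nz in simp)
qed

end

context supersmooth_deconvolution begin

text \<open>The real part of the deconvolution kernel \<open>w\<^sub>\<rho>\<close> at the reflected
  argument \<open>- u\<close>. The reflection is the reason why it is evaluated at (X - x)/h and not
  at (x - X)/h.\<close>

definition kde_weight :: "real \<Rightarrow> real \<Rightarrow> real" where
  "kde_weight \<rho> u = Re (CLINT s|lborel. iexp (s * u) * (\<phi>\<^sub>w s / \<phi>\<^sub>k (s / \<rho>))) / (2 * pi)"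

lemma kde_weight_measurable [measurable]: "kde_weight \<rho> \<in> borel_measurable borel"
  unfolding kde_weight_def[abs_def] by measurable

text \<open>This bound may depend on \<rho>. It secures integrability at every single n, also where
  the uniform edge estimates are not yet available.\<close>

lemma kde_weight_bounded:
  assumes "\<rho> > 0"
  shows "\<exists>B. \<forall>u. \<bar>kde_weight \<rho> u\<bar> \<le> B"
proof (intro exI allI)
  fix u
  have "\<bar>Re (CLINT s|lborel. iexp (s * u) * (\<phi>\<^sub>w s / \<phi>\<^sub>k (s / \<rho>)))\<bar>
      \<le> norm (CLINT s|lborel. iexp (s * u) * (\<phi>\<^sub>w s / \<phi>\<^sub>k (s / \<rho>)))"
    by (rule abs_Re_le_cmod)
  also have "\<dots> \<le> (\<integral>s. norm (iexp (s * u) * (\<phi>\<^sub>w s / \<phi>\<^sub>k (s / \<rho>))) \<partial>lborel)"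
    by (rule integral_norm_bound)
  also have "\<dots> = (\<integral>s. norm (\<phi>\<^sub>w s / \<phi>\<^sub>k (s / \<rho>)) \<partial>lborel)"
    by (simp only: norm_mult norm_exp_i_times mult_1)
  finally show "\<bar>kde_weight \<rho> u\<bar> \<le> (\<integral>s. norm (\<phi>\<^sub>w s / \<phi>\<^sub>k (s / \<rho>)) \<partial>lborel) / (2 * pi)"
    by (simp add: kde_weight_def divide_right_mono)
qed

lemma deconv_kde_eq:
  assumes h: "h > 0" and \<sigma>: "\<sigma> > 0"
  shows "deconv_kde \<phi>\<^sub>w \<phi>\<^sub>k h \<sigma> n X x = (\<Sum>j = 1..n. kde_weight (h / \<sigma>) ((X j - x) / h)) / (real n * h)"
proof -
  let ?G = "\<lambda>j s. iexp (s * ((X j - x) / h)) * (\<phi>\<^sub>w s / \<phi>\<^sub>k (s / (h / \<sigma>)))"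
  have G: "complex_integrable lborel (?G j)" for j
    using h \<sigma> by (intro integrable_iexp_mult integrable_ft_ratio) auto
  have G': "complex_integrable lborel (\<lambda>t. ?G j (0 + h * t))" for j
    using h by (intro lborel_integrable_real_affine G) auto
  have sub: "(CLINT t|lborel. ?G j (0 + h * t)) = (CLINT s|lborel. ?G j s) / h" for j
    using h by (subst (2) lborel_integral_real_affine[of h _ 0]) (auto simp: scaleR_conv_of_real)
  have "iexp (- (t * x)) * (\<phi>\<^sub>w (h * t) * emp_cf n X t / \<phi>\<^sub>k (\<sigma> * t)) = (\<Sum>j = 1..n. ?G j (0 + h * t)) / n" for t
  proof -
    have eq: "?G j (0 + h * t) = iexp (- (t * x)) * iexp (t * X j) * (\<phi>\<^sub>w (h * t) / \<phi>\<^sub>k (\<sigma> * t))" for j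
    proof -
      have "(h * t) * ((X j - x) / h) = - (t * x) + t * X j" "h * t / (h / \<sigma>) = \<sigma> * t"
        using h by (simp_all add: field_simps)
      then show ?thesis by (simp only: add_0 of_real_add distrib_left exp_add)
    qed
    show ?thesis
      unfolding eq emp_cf_def by (simp add: sum_distrib_left sum_distrib_right sum_divide_distrib mult_ac)
  qed
  then have "deconv_kde \<phi>\<^sub>w \<phi>\<^sub>k h \<sigma> n X x = Re (1 / (2 * pi) * (CLINT t|lborel. (\<Sum>j = 1..n. ?G j (0 + h * t)) / n))"
    by (simp only: deconv_kde_def)
  also have "(CLINT t|lborel. (\<Sum>j = 1..n. ?G j (0 + h * t)) / n) = (\<Sum>j = 1..n. (CLINT s|lborel. ?G j s) / h) / n"
    by (subst integral_divide_zero, subst Bochner_Integration.integral_sum[OF G'], subst sub) (rule refl)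
  also have "Re (1 / (2 * pi) * \<dots>) = (\<Sum>j = 1..n. kde_weight (h / \<sigma>) ((X j - x) / h)) / (real n * h)"
  proof -
    have "complex_of_real (1 / (2 * pi)) * ((\<Sum>j = 1..n. (CLINT s|lborel. ?G j s) / h) / n)
        = (\<Sum>j = 1..n. complex_of_real (1 / (2 * pi * h * n)) * (CLINT s|lborel. ?G j s))"
      by (simp add: sum_distrib_left sum_divide_distrib mult_ac)
    then show ?thesis
      by (simp add: kde_weight_def sum_divide_distrib mult_ac)
  qed
  finally show ?thesis .
qed

end

section \<open>The observations\<close>

text \<open>The cosine is the real part of an exponential, and the shift by \<open>x\<close> only
  contributes a factor of modulus 1 to the characteristic function.\<close>

lemma (in prob_space) abs_expectation_cos_le:
  assumes [measurable]: "X \<in> borel_measurable M"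
  shows "\<bar>expectation (\<lambda>\<omega>. cos (a * (X \<omega> - x)))\<bar> \<le> norm (char (distr M borel X) a)"
proof -
  have int: "integrable M (\<lambda>\<omega>. iexp (a * (X \<omega> - x)))"
    by (intro integrable_const_bound[of _ 1]) auto
  have "expectation (\<lambda>\<omega>. cos (a * (X \<omega> - x))) = Re (CLINT \<omega>|M. iexp (a * (X \<omega> - x)))"
    by (subst integral_Re[OF int, symmetric]) (simp add: Re_exp)
  also have "(CLINT \<omega>|M. iexp (a * (X \<omega> - x))) = (CLINT \<omega>|M. iexp (- (a * x)) * iexp (a * X \<omega>))"
    by (simp add: algebra_simps flip: exp_add)
  also have "\<dots> = iexp (- (a * x)) * char (distr M borel X) a"
    by (simp add: char_def integral_distr)
  also have "\<bar>Re (iexp (- (a * x)) * char (distr M borel X) a)\<bar> \<le> norm (char (distr M borel X) a)"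
    using abs_Re_le_cmod[of "iexp (- (a * x)) * char (distr M borel X) a"] by (simp add: norm_mult)
  finally show ?thesis .
qed

text \<open>The second moment is compared through the difference of squares: one factor is at most K
  + |b|, the other is the approximation error. Then cos^2 = (1 + cos of the double angle) / 2 gives
  the main term b^2/2 and the characteristic function at \<open>2 * a\<close>. The error may grow
  linearly in |y - x|, so an absolute first moment is the quantity that has to be
  controlled.\<close>

lemma (in prob_space) moments_of_approx_cos:
  assumes X: "integrable M X" and m: "expectation (\<lambda>\<omega>. \<bar>X \<omega> - x\<bar>) \<le> m"
    and [measurable]: "g \<in> borel_measurable borel" and K: "\<And>y. \<bar>g y\<bar> \<le> K"
    and d: "d \<ge> 0" and approx: "\<And>y. \<bar>g y - b * cos (a * (y - x))\<bar> \<le> e + d * \<bar>y - x\<bar>"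
  shows "\<bar>expectation (\<lambda>\<omega>. g (X \<omega>))\<bar> \<le> e + d * m + \<bar>b\<bar> * norm (char (distr M borel X) a)"
    and "\<bar>expectation (\<lambda>\<omega>. (g (X \<omega>))\<^sup>2) - b\<^sup>2 / 2\<bar>
      \<le> (K + \<bar>b\<bar>) * (e + d * m) + b\<^sup>2 / 2 * norm (char (distr M borel X) (2 * a))"
proof -
  have [measurable]: "X \<in> borel_measurable M" using X by auto
  let ?c = "\<lambda>\<omega>. b * cos (a * (X \<omega> - x))"
  have K0: "K \<ge> 0" using K[of 0] by linarith
  have "\<bar>?c \<omega>\<bar> \<le> \<bar>b\<bar>" "(?c \<omega>)\<^sup>2 \<le> b\<^sup>2" "(g (X \<omega>))\<^sup>2 \<le> K\<^sup>2" for \<omega>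
    using K[of "X \<omega>"] K0
    by (auto simp: abs_mult power_mult_distrib mult_left_le abs_square_le_1 abs_le_square_iff[symmetric])
  then have int: "integrable M (\<lambda>\<omega>. g (X \<omega>))" "integrable M ?c"
    "integrable M (\<lambda>\<omega>. (g (X \<omega>))\<^sup>2)" "integrable M (\<lambda>\<omega>. (?c \<omega>)\<^sup>2)"
    using K by (auto intro: integrable_const_bound[of _ K] integrable_const_bound[of _ 1]
        integrable_const_bound[of _ "K\<^sup>2"] integrable_const_bound[of _ "b\<^sup>2"])
  have bd: "expectation (\<lambda>\<omega>. e + d * \<bar>X \<omega> - x\<bar>) \<le> e + d * m"
    using X m d by (subst Bochner_Integration.integral_add) (auto simp: prob_space mult_left_mono)
  have int_bd: "integrable M (\<lambda>\<omega>. e + d * \<bar>X \<omega> - x\<bar>)" using X by auto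
  have "\<bar>expectation (\<lambda>\<omega>. g (X \<omega>) - ?c \<omega>)\<bar> \<le> expectation (\<lambda>\<omega>. e + d * \<bar>X \<omega> - x\<bar>)"
    using int int_bd approx by (intro order.trans[OF integral_abs_bound integral_mono]) auto
  then have 1: "\<bar>expectation (\<lambda>\<omega>. g (X \<omega>)) - expectation ?c\<bar> \<le> e + d * m"
    using bd int by simp
  have "\<bar>expectation ?c\<bar> \<le> \<bar>b\<bar> * norm (char (distr M borel X) a)"
    by (simp add: abs_mult mult_left_mono abs_expectation_cos_le)
  with 1 show "\<bar>expectation (\<lambda>\<omega>. g (X \<omega>))\<bar> \<le> e + d * m + \<bar>b\<bar> * norm (char (distr M borel X) a)"
    by linarith
  have "\<bar>expectation (\<lambda>\<omega>. (g (X \<omega>))\<^sup>2 - (?c \<omega>)\<^sup>2)\<bar> \<le> expectation (\<lambda>\<omega>. (K + \<bar>b\<bar>) * (e + d * \<bar>X \<omega> - x\<bar>))"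
  proof (intro order.trans[OF integral_abs_bound integral_mono])
    fix \<omega>
    have "\<bar>(g (X \<omega>))\<^sup>2 - (?c \<omega>)\<^sup>2\<bar> = \<bar>g (X \<omega>) + ?c \<omega>\<bar> * \<bar>g (X \<omega>) - ?c \<omega>\<bar>"
      by (simp add: square_diff_square_factored power2_eq_square abs_mult)
    also have "\<dots> \<le> (K + \<bar>b\<bar>) * (e + d * \<bar>X \<omega> - x\<bar>)"
    proof (intro mult_mono approx)
      have "\<bar>?c \<omega>\<bar> \<le> \<bar>b\<bar>" by (simp add: abs_mult mult_left_le)
      then show "\<bar>g (X \<omega>) + ?c \<omega>\<bar> \<le> K + \<bar>b\<bar>" using K[of "X \<omega>"] by linarith
    qed (use K0 in auto)
    finally show "\<bar>(g (X \<omega>))\<^sup>2 - (?c \<omega>)\<^sup>2\<bar> \<le> (K + \<bar>b\<bar>) * (e + d * \<bar>X \<omega> - x\<bar>)" .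
  qed (use int int_bd in auto)
  also have "\<dots> \<le> (K + \<bar>b\<bar>) * (e + d * m)"
    using bd K0 by (subst integral_mult_right_zero) (intro mult_left_mono, auto)
  finally have 2: "\<bar>expectation (\<lambda>\<omega>. (g (X \<omega>))\<^sup>2) - expectation (\<lambda>\<omega>. (?c \<omega>)\<^sup>2)\<bar> \<le> (K + \<bar>b\<bar>) * (e + d * m)"
    using int by simp
  have "expectation (\<lambda>\<omega>. (?c \<omega>)\<^sup>2) = expectation (\<lambda>\<omega>. b\<^sup>2 / 2 + b\<^sup>2 / 2 * cos (2 * a * (X \<omega> - x)))"
  proof (intro Bochner_Integration.integral_cong refl)
    fix \<omega>
    have "cos (2 * a * (X \<omega> - x)) = 2 * (cos (a * (X \<omega> - x)))\<^sup>2 - 1"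
      using cos_double_cos[of "a * (X \<omega> - x)"] by (simp add: mult.assoc)
    then show "(?c \<omega>)\<^sup>2 = b\<^sup>2 / 2 + b\<^sup>2 / 2 * cos (2 * a * (X \<omega> - x))"
      by (simp add: power_mult_distrib right_diff_distrib)
  qed
  also have "\<dots> = b\<^sup>2 / 2 + b\<^sup>2 / 2 * expectation (\<lambda>\<omega>. cos (2 * a * (X \<omega> - x)))"
  proof -
    have "integrable M (\<lambda>\<omega>. cos (2 * a * (X \<omega> - x)))"
      by (intro integrable_const_bound[of _ 1]) auto
    then have "integrable M (\<lambda>\<omega>. b\<^sup>2 / 2 * cos (2 * a * (X \<omega> - x)))"
      by (rule integrable_mult_right)
    then show ?thesis
      by (subst Bochner_Integration.integral_add) (auto simp: prob_space)
  qed
  finally have "\<bar>expectation (\<lambda>\<omega>. (?c \<omega>)\<^sup>2) - b\<^sup>2 / 2\<bar> \<le> b\<^sup>2 / 2 * norm (char (distr M borel X) (2 * a))"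
    using mult_left_mono[OF abs_expectation_cos_le[of X "2 * a" x], of "b\<^sup>2 / 2"] by (simp add: abs_mult)
  with 2 show "\<bar>expectation (\<lambda>\<omega>. (g (X \<omega>))\<^sup>2) - b\<^sup>2 / 2\<bar>
      \<le> (K + \<bar>b\<bar>) * (e + d * m) + b\<^sup>2 / 2 * norm (char (distr M borel X) (2 * a))"
    by linarith
qed

section \<open>Laws and moments within one row of observations\<close>

lemma real_distribution_density:
  "prob_density f \<Longrightarrow> real_distribution (density lborel (\<lambda>x. ennreal (f x)))"
  by (auto simp: prob_density_def real_distribution_def real_distribution_axioms_def)

lemma dens_cf_eq_char:
  assumes "prob_density f"
  shows "dens_cf f = char (density lborel (\<lambda>x. ennreal (f x)))"
proof
  fix t
  have [measurable]: "f \<in> borel_measurable borel" and "\<And>x. f x \<ge> 0"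
    using assms by (auto simp: prob_density_def)
  then show "dens_cf f t = char (density lborel (\<lambda>x. ennreal (f x))) t"
    unfolding dens_cf_def char_def
    by (subst integral_density) (auto simp: scaleR_conv_of_real mult.commute)
qed

context
  fixes M :: "'a measure" and f k :: "real \<Rightarrow> real" and n :: nat and Y Z :: "nat \<Rightarrow> 'a \<Rightarrow> real"
  assumes sample: "deconv_sample M f k n Y Z"
begin

interpretation prob_space M using sample by (simp add: deconv_sample_def)

lemma deconv_sample_distributed:
  "j \<in> {1..n} \<Longrightarrow> distributed M lborel (Y j) f" "j \<in> {1..n} \<Longrightarrow> distributed M lborel (Z j) k"
  using sample by (auto simp: deconv_sample_def)

lemma deconv_sample_measurable:
  "j \<in> {1..n} \<Longrightarrow> Y j \<in> borel_measurable M" "j \<in> {1..n} \<Longrightarrow> Z j \<in> borel_measurable M"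
  using deconv_sample_distributed[THEN distributed_measurable] by auto

lemma deconv_sample_indep: "indep_vars (\<lambda>_. borel) (case_sum Y Z) ({1..n} <+> {1..n})"
  using sample by (simp add: deconv_sample_def)

text \<open>The blocks {Inl j, Inr j} are disjoint for different j, and functions of disjoint blocks
  of an independent family are independent.\<close>

lemma deconv_sample_indep_sum:
  "indep_vars (\<lambda>_. borel) (\<lambda>j \<omega>. Y j \<omega> + s * Z j \<omega>) {1..n}"
proof -
  have "indep_vars (\<lambda>j. PiM {Inl j, Inr j} (\<lambda>_. borel)) (\<lambda>j \<omega>. restrict (\<lambda>i. case_sum Y Z i \<omega>) {Inl j, Inr j}) {1..n}"
    by (rule indep_vars_restrict[OF deconv_sample_indep]) (auto simp: disjoint_family_on_def)
  then have "indep_vars (\<lambda>_. borel) (\<lambda>j \<omega>. (\<lambda>p. p (Inl j) + s * p (Inr j))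
      (restrict (\<lambda>i. case_sum Y Z i \<omega>) {Inl j, Inr j})) {1..n}"
    by (rule indep_vars_compose2) measurable
  then show ?thesis by simp
qed

lemma deconv_sample_indep_pair:
  assumes j: "j \<in> {1..n}"
  shows "indep_var borel (Y j) borel (Z j)"
proof -
  have "indep_var (PiM {Inl j} (\<lambda>_. borel)) (\<lambda>\<omega>. restrict (\<lambda>i. case_sum Y Z i \<omega>) {Inl j})
      (PiM {Inr j} (\<lambda>_. borel)) (\<lambda>\<omega>. restrict (\<lambda>i. case_sum Y Z i \<omega>) {Inr j})"
    using j by (intro indep_var_restrict[OF deconv_sample_indep]) auto
  then have "indep_var borel ((\<lambda>p. p (Inl j)) \<circ> (\<lambda>\<omega>. restrict (\<lambda>i. case_sum Y Z i \<omega>) {Inl j}))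
      borel ((\<lambda>p. p (Inr j)) \<circ> (\<lambda>\<omega>. restrict (\<lambda>i. case_sum Y Z i \<omega>) {Inr j}))"
    by (rule indep_var_compose) measurable
  then show ?thesis by (simp add: comp_def)
qed

lemma char_deconv_sample:
  assumes f: "prob_density f" and k: "prob_density k" and j: "j \<in> {1..n}"
  shows "char (distr M borel (\<lambda>\<omega>. Y j \<omega> + s * Z j \<omega>)) t = dens_cf f t * dens_cf k (s * t)"
proof -
  note [measurable] = deconv_sample_measurable[OF j]
  \<comment> \<open>\<open>distributed\<close> speaks of the image measure with respect to
    \<open>lborel\<close>, while \<open>char_distr_add\<close> works with \<open>borel\<close>. The
    two have the same sets, so the image measures agree.\<close>
  have law: "distr M borel V = density lborel g" if "distributed M lborel V g" for V and g :: "real \<Rightarrow> ennreal"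
    using distributed_distr_eq_density[OF that] by (subst distr_cong[OF refl _ refl, of borel lborel]) auto
  have "indep_var borel (Y j) borel (\<lambda>\<omega>. s * Z j \<omega>)"
    using indep_var_compose[OF deconv_sample_indep_pair[OF j], of "\<lambda>y. y" borel "\<lambda>z. s * z" borel]
    by (simp add: comp_def)
  then have "char (distr M borel (\<lambda>\<omega>. Y j \<omega> + s * Z j \<omega>)) t
      = char (distr M borel (Y j)) t * char (distr M borel (\<lambda>\<omega>. s * Z j \<omega>)) t"
    by (rule char_distr_add)
  also have "char (distr M borel (\<lambda>\<omega>. s * Z j \<omega>)) t = char (distr M borel (Z j)) (s * t)"
    by (simp add: char_def integral_distr mult_ac)
  finally show ?thesis
    using deconv_sample_distributed[OF j] by (simp add: law dens_cf_eq_char f k)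
qed

text \<open>By |y| \<le> 1 + y^2 the bound is expressed through the two densities. Apart from
  \<open>s\<close> and \<open>x\<close> nothing in it refers to the row or the probability space,
  which makes it uniform along the array.\<close>

lemma deconv_sample_abs_moment:
  assumes f: "prob_density f" and k: "prob_density k" and j: "j \<in> {1..n}"
    and Y: "integrable M (\<lambda>\<omega>. (Y j \<omega>)\<^sup>2)" and Z: "integrable M (\<lambda>\<omega>. (Z j \<omega>)\<^sup>2)"
  shows "integrable M (\<lambda>\<omega>. Y j \<omega> + s * Z j \<omega>)"
    and "expectation (\<lambda>\<omega>. \<bar>Y j \<omega> + s * Z j \<omega> - x\<bar>)
      \<le> 1 + (\<integral>y. f y * y\<^sup>2 \<partial>lborel) + \<bar>s\<bar> * (1 + (\<integral>z. k z * z\<^sup>2 \<partial>lborel)) + \<bar>x\<bar>"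
proof -
  note [measurable] = deconv_sample_measurable[OF j]
  have iY: "integrable M (Y j)" and iZ: "integrable M (Z j)"
    by (rule square_integrable_imp_integrable[OF _ Y], simp) (rule square_integrable_imp_integrable[OF _ Z], simp)
  show int: "integrable M (\<lambda>\<omega>. Y j \<omega> + s * Z j \<omega>)" using iY iZ by auto
  have le: "\<bar>y::real\<bar> \<le> 1 + y\<^sup>2" for y
    using zero_le_power2[of "\<bar>y\<bar> - 1"] by (simp add: power2_diff)
  have "expectation (\<lambda>\<omega>. \<bar>Y j \<omega> + s * Z j \<omega> - x\<bar>)
      \<le> expectation (\<lambda>\<omega>. 1 + (Y j \<omega>)\<^sup>2 + \<bar>s\<bar> * (1 + (Z j \<omega>)\<^sup>2) + \<bar>x\<bar>)"
  proof (rule integral_mono)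
    fix \<omega>
    have "\<bar>s * Z j \<omega>\<bar> \<le> \<bar>s\<bar> * (1 + (Z j \<omega>)\<^sup>2)"
      unfolding abs_mult by (intro mult_left_mono le) auto
    then show "\<bar>Y j \<omega> + s * Z j \<omega> - x\<bar> \<le> 1 + (Y j \<omega>)\<^sup>2 + \<bar>s\<bar> * (1 + (Z j \<omega>)\<^sup>2) + \<bar>x\<bar>"
      using le[of "Y j \<omega>"] by linarith
  qed (use int Y Z in auto)
  also have "\<dots> = 1 + expectation (\<lambda>\<omega>. (Y j \<omega>)\<^sup>2) + \<bar>s\<bar> * (1 + expectation (\<lambda>\<omega>. (Z j \<omega>)\<^sup>2)) + \<bar>x\<bar>"
    using Y Z by (simp add: prob_space)
  also have "expectation (\<lambda>\<omega>. (Y j \<omega>)\<^sup>2) = (\<integral>y. f y * y\<^sup>2 \<partial>lborel)"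
    using f by (intro distributed_integral[OF deconv_sample_distributed(1)[OF j], symmetric]) (auto simp: prob_density_def)
  also have "expectation (\<lambda>\<omega>. (Z j \<omega>)\<^sup>2) = (\<integral>y. k y * y\<^sup>2 \<partial>lborel)"
    using k by (intro distributed_integral[OF deconv_sample_distributed(2)[OF j], symmetric]) (auto simp: prob_density_def)
  finally show "expectation (\<lambda>\<omega>. \<bar>Y j \<omega> + s * Z j \<omega> - x\<bar>)
      \<le> 1 + (\<integral>y. f y * y\<^sup>2 \<partial>lborel) + \<bar>s\<bar> * (1 + (\<integral>z. k z * z\<^sup>2 \<partial>lborel)) + \<bar>x\<bar>" .
qed

end

section \<open>Asymptotic normality\<close>

theorem theorem2:
  fixes M :: "nat \<Rightarrow> 'a measure"
    and Y Z :: "nat \<Rightarrow> nat \<Rightarrow> 'a \<Rightarrow> real"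
    and f k w :: "real \<Rightarrow> real"
    and \<phi>\<^sub>w :: "real \<Rightarrow> complex"
    and h \<sigma> \<rho> :: "nat \<Rightarrow> real"
    and \<zeta> :: "real \<Rightarrow> real"
    and T :: "nat \<Rightarrow> 'a \<Rightarrow> real"
    and x lam lam0 \<mu> C A \<alpha> :: real
  assumes dens_f: "prob_density f" and dens_k: "prob_density k"
    and kernel: "kernel_with_ft w \<phi>\<^sub>w"
    and h_pos: "\<And>n. h n > 0" and \<sigma>_pos: "\<And>n. \<sigma> n > 0"
    and f_cf: "complex_integrable lborel (dens_cf f)"
    and k_cf_nz: "\<And>t. dens_cf k t \<noteq> 0"
    and k_cf: "dens_cf k \<sim>[at_infinity]
      (\<lambda>t. complex_of_real (C * \<bar>t\<bar> powr lam0 * exp (- (\<bar>t\<bar> powr lam) / \<mu>)))"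
    and lam: "lam > 1" and \<mu>: "\<mu> > 0"
    and w_bdd: "bounded (range w)"
    and w_sym: "\<And>u. w (- u) = w u"
    and w_cont: "continuous_on UNIV w"
    and \<phi>w_supp: "\<And>t. t \<notin> {-1..1} \<Longrightarrow> \<phi>\<^sub>w t = 0"
    and \<phi>w_0: "\<phi>\<^sub>w 0 = 1"
    and \<phi>w_le: "\<And>t. norm (\<phi>\<^sub>w t) \<le> 1"
    and \<alpha>: "\<alpha> \<ge> 0"
    and \<phi>w_edge: "(\<lambda>t. \<phi>\<^sub>w (1 - t) - complex_of_real (A * t powr \<alpha>))
      \<in> o[at_right 0](\<lambda>t. complex_of_real (t powr \<alpha>))"
    and h_lim: "h \<longlonglongrightarrow> 0"
    and nh_lim: "filterlim (\<lambda>n. real n * h n) at_top sequentially"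
    and \<sigma>_lim: "\<sigma> \<longlonglongrightarrow> 0"
    and \<sigma>h_lim: "filterlim (\<lambda>n. \<sigma> n powr lam / h n powr (lam - 1)) at_top sequentially"
    and sample: "\<And>n. deconv_sample (M n) f k n (Y n) (Z n)"
    and Y_sq: "\<And>n j. j \<in> {1..n} \<Longrightarrow> integrable (M n) (\<lambda>\<omega>. (Y n j \<omega>)\<^sup>2)"
    and Z_sq: "\<And>n j. j \<in> {1..n} \<Longrightarrow> integrable (M n) (\<lambda>\<omega>. (Z n j \<omega>)\<^sup>2)"
  defines "\<rho> \<equiv> \<lambda>n. h n / \<sigma> n"
    and "\<zeta> \<equiv> \<lambda>r. exp (1 / (\<mu> * r powr lam))"
    and "T \<equiv> \<lambda>n \<omega>. deconv_kde \<phi>\<^sub>w (dens_cf k) (h n) (\<sigma> n) n (\<lambda>j. Y n j \<omega> + \<sigma> n * Z n j \<omega>) x"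
  shows "weak_conv_m
    (\<lambda>n. distr (M n) borel (\<lambda>\<omega>.
       sqrt (real n) * \<sigma> n / (\<rho> n powr (lam * (1 + \<alpha>) + lam0 - 1) * \<zeta> (\<rho> n))
         * (T n \<omega> - prob_space.expectation (M n) (T n))))
    (normal_law 0 (A\<^sup>2 / (2 * pi\<^sup>2 * C\<^sup>2) * (\<mu> / lam) powr (2 + 2 * \<alpha>) * (Gamma (\<alpha> + 1))\<^sup>2))"
proof -
  interpret K: real_distribution "density lborel (\<lambda>x. ennreal (k x))"
    by (rule real_distribution_density[OF dens_k])
  interpret F: real_distribution "density lborel (\<lambda>x. ennreal (f x))"
    by (rule real_distribution_density[OF dens_f])
  interpret sd: supersmooth_deconvolution "dens_cf k" lam lam0 \<mu> C \<phi>\<^sub>w A \<alpha>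
  proof
    show "continuous_on UNIV (dens_cf k)"
      using K.isCont_char by (simp add: dens_cf_eq_char[OF dens_k] continuous_at_imp_continuous_on)
    show "\<phi>\<^sub>w \<in> borel_measurable borel"
      using kernel by (auto simp: kernel_with_ft_def dest: borel_measurable_integrable)
    show "AE t in lborel. \<phi>\<^sub>w (- t) = \<phi>\<^sub>w t"
      by (rule kernel_ft_even[OF kernel w_sym])
  qed (fact k_cf_nz k_cf lam \<mu> \<phi>w_le \<phi>w_supp \<alpha> \<phi>w_edge)+

  \<comment> \<open>Scales, normalisation and the cosine approximation\<close>
  have \<rho>_pos: "\<rho> n > 0" for n using h_pos \<sigma>_pos by (simp add: \<rho>_def)
  \<comment> \<open>\<delta> is the size of the phase change over the edge scale, per unit of |X -
    x|. It is the reciprocal of the quantity that tends to infinity in condition (v).\<close>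
  define \<delta> where "\<delta> n = \<rho> n powr lam / h n" for n
  have \<delta>_eq: "\<delta> n = inverse (\<sigma> n powr lam / h n powr (lam - 1))" for n
    using h_pos[of n] \<sigma>_pos[of n] by (simp add: \<delta>_def \<rho>_def powr_divide powr_diff)
  have \<delta>: "\<delta> \<longlonglongrightarrow> 0"
    using tendsto_inverse_0_at_top[OF \<sigma>h_lim] by (simp only: \<delta>_eq[symmetric])
  \<comment> \<open>That \<rho> tends to 0 is not among the assumptions; it follows from \<rho>^lam
    = \<delta> h.\<close>
  have "(\<lambda>n. (\<delta> n * h n) powr (1 / lam)) \<longlonglongrightarrow> 0"
    using lam h_pos \<rho>_pos
    by (intro tendsto_zero_powrI[of _ _ _ "1 / lam"] tendsto_mult_zero \<delta> h_lim)
      (auto intro!: always_eventually less_imp_le simp: \<delta>_def)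
  moreover have "(\<delta> n * h n) powr (1 / lam) = \<rho> n" for n
    using lam h_pos[of n] \<rho>_pos[of n] by (simp add: \<delta>_def powr_powr)
  ultimately have \<rho>_lim: "\<rho> \<longlonglongrightarrow> 0" by simp

  define N where "N n = \<rho> n powr (lam * (1 + \<alpha>) + lam0) * \<zeta> (\<rho> n)" for n
  have N_pos: "N n > 0" for n using \<rho>_pos[of n] by (simp add: N_def \<zeta>_def)
  define X where "X n j \<omega> = Y n j \<omega> + \<sigma> n * Z n j \<omega>" for n j \<omega>
  define g where "g n y = sd.kde_weight (\<rho> n) ((y - x) / h n) / N n" for n y
  \<comment> \<open>The amplitude 2 \<open>sd.edge_const\<close> of the cosine, divided by the 2 pi
    of the inversion formula.\<close>
  define b where "b = sd.edge_const / pi"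
  have [measurable]: "g n \<in> borel_measurable borel" for n
    unfolding g_def[abs_def] by measurable
  obtain K \<epsilon> where K: "K > 0" and \<epsilon>: "\<epsilon> \<longlonglongrightarrow> 0"
    and "\<forall>\<^sub>F n in sequentially. \<forall>u.
     norm ((CLINT s|lborel. iexp (s * u) * (\<phi>\<^sub>w s / dens_cf k (s / \<rho> n)))
       / (\<rho> n powr (lam * (1 + \<alpha>) + lam0) * exp (1 / (\<mu> * \<rho> n powr lam)))) \<le> K \<and>
     norm ((CLINT s|lborel. iexp (s * u) * (\<phi>\<^sub>w s / dens_cf k (s / \<rho> n)))
       / (\<rho> n powr (lam * (1 + \<alpha>) + lam0) * exp (1 / (\<mu> * \<rho> n powr lam))) - 2 * sd.edge_const * cos u)
       \<le> \<epsilon> n + K * \<bar>u\<bar> * \<rho> n powr lam"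
    using sd.ft_ratio_integral_edge[OF \<rho>_lim \<rho>_pos] by blast
  then have edge: "\<forall>\<^sub>F n in sequentially. \<forall>u.
     norm ((CLINT s|lborel. iexp (s * u) * (\<phi>\<^sub>w s / dens_cf k (s / \<rho> n))) / complex_of_real (N n)) \<le> K \<and>
     norm ((CLINT s|lborel. iexp (s * u) * (\<phi>\<^sub>w s / dens_cf k (s / \<rho> n))) / complex_of_real (N n)
       - complex_of_real (2 * sd.edge_const * cos u)) \<le> \<epsilon> n + K * \<bar>u\<bar> * \<rho> n powr lam"
    by (simp only: N_def \<zeta>_def)
  have g_bounds: "\<forall>\<^sub>F n in sequentially. \<forall>y. \<bar>g n y\<bar> \<le> K \<and>
      \<bar>g n y - b * cos (1 / h n * (y - x))\<bar> \<le> \<bar>\<epsilon> n\<bar> + K * \<delta> n * \<bar>y - x\<bar>"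
    using edge
  proof (eventually_elim, intro allI)
    fix n y
    assume n: "\<forall>u.
     norm ((CLINT s|lborel. iexp (s * u) * (\<phi>\<^sub>w s / dens_cf k (s / \<rho> n))) / complex_of_real (N n)) \<le> K \<and>
     norm ((CLINT s|lborel. iexp (s * u) * (\<phi>\<^sub>w s / dens_cf k (s / \<rho> n))) / complex_of_real (N n)
       - complex_of_real (2 * sd.edge_const * cos u)) \<le> \<epsilon> n + K * \<bar>u\<bar> * \<rho> n powr lam"
    define u where "u = (y - x) / h n"
    define I where "I = (CLINT s|lborel. iexp (s * u) * (\<phi>\<^sub>w s / dens_cf k (s / \<rho> n))) / complex_of_real (N n)"
    have I: "norm I \<le> K" "norm (I - complex_of_real (2 * sd.edge_const * cos u)) \<le> \<epsilon> n + K * \<bar>u\<bar> * \<rho> n powr lam"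
      using n unfolding I_def by blast+
    have le: "\<bar>Re z / (2 * pi)\<bar> \<le> norm z" for z
    proof -
      have "\<bar>Re z / (2 * pi)\<bar> = \<bar>Re z\<bar> / (2 * pi)" by simp
      also have "\<dots> \<le> \<bar>Re z\<bar> / 1" using pi_ge_two by (intro divide_left_mono) auto
      also have "\<dots> \<le> norm z" using abs_Re_le_cmod[of z] by simp
      finally show ?thesis .
    qed
    have g: "g n y = Re I / (2 * pi)"
      by (simp add: g_def I_def u_def sd.kde_weight_def Re_divide_of_real)
    have u: "1 / h n * (y - x) = u" by (simp add: u_def)
    have "g n y - b * cos u = Re (I - complex_of_real (2 * sd.edge_const * cos u)) / (2 * pi)"
      by (simp add: g b_def diff_divide_distrib)
    then have "\<bar>g n y - b * cos u\<bar> \<le> \<epsilon> n + K * \<bar>u\<bar> * \<rho> n powr lam"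
      using le I(2) by (metis order.trans)
    also have "K * \<bar>u\<bar> * \<rho> n powr lam = K * \<delta> n * \<bar>y - x\<bar>"
      using h_pos[of n] by (simp add: u_def \<delta>_def)
    finally have "\<bar>g n y - b * cos (1 / h n * (y - x))\<bar> \<le> \<bar>\<epsilon> n\<bar> + K * \<delta> n * \<bar>y - x\<bar>"
      unfolding u by linarith
    then show "\<bar>g n y\<bar> \<le> K \<and> \<bar>g n y - b * cos (1 / h n * (y - x))\<bar> \<le> \<bar>\<epsilon> n\<bar> + K * \<delta> n * \<bar>y - x\<bar>"
      using le[of I] I(1) by (simp add: g)
  qed
  \<comment> \<open>\<open>g_bounds\<close> speaks of large n only, but the final rewriting of the
    statistic takes expectations at every n, so some bound is needed for each of them.\<close>
  have g_bdd: "\<exists>B. \<forall>y. \<bar>g n y\<bar> \<le> B" for n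
  proof -
    obtain B where "\<And>u. \<bar>sd.kde_weight (\<rho> n) u\<bar> \<le> B" using sd.kde_weight_bounded[OF \<rho>_pos] by blast
    then have "\<bar>g n y\<bar> \<le> B / N n" for y
      using N_pos[of n] by (simp add: g_def divide_right_mono)
    then show ?thesis by blast
  qed

  have M: "prob_space (M n)" for n using sample by (simp add: deconv_sample_def)
  have X_meas: "X n j \<in> borel_measurable (M n)" if "j \<in> {1..n}" for n j
    using deconv_sample_measurable[OF sample that] unfolding X_def[abs_def] by measurable
  have char_X: "char (distr (M n) borel (X n j)) t = dens_cf f t * dens_cf k (\<sigma> n * t)" if "j \<in> {1..n}" for n j t
    unfolding X_def[abs_def] by (rule char_deconv_sample[OF sample dens_f dens_k that])
  \<comment> \<open>The characteristic function in \<open>char_X\<close> does not involve j, so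
    uniqueness gives equal laws within a row.\<close>
  have X_law: "distr (M n) borel (X n j) = distr (M n) borel (X n 1)" if "j \<in> {1..n}" for n j
    using that by (intro Levy_uniqueness ext prob_space.real_distribution_distr[OF M] X_meas) (auto simp: char_X)
  have char_lim: "(\<lambda>n. norm (dens_cf k (c / \<rho> n))) \<longlonglongrightarrow> 0" if "c > 0" for c
  proof -
    have "filterlim (\<lambda>n. c / \<rho> n) at_top sequentially"
      unfolding divide_inverse using \<rho>_pos
      by (intro filterlim_tendsto_pos_mult_at_top[OF tendsto_const that] filterlim_inverse_at_top \<rho>_lim always_eventually) auto
    from filterlim_compose[OF sd.cf_tendsto_0 this] show ?thesis by (rule tendsto_norm_zero)
  qed
  have char_le: "norm (char (distr (M n) borel (X n 1)) (c / h n)) \<le> norm (dens_cf k (c / \<rho> n))"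
    if "n \<ge> 1" for n c
  proof -
    have "\<sigma> n * (c / h n) = c / \<rho> n" using h_pos[of n] \<sigma>_pos[of n] by (simp add: \<rho>_def)
    moreover have "norm (dens_cf f t) \<le> 1" for t
      using F.cmod_char_le_1 by (simp add: dens_cf_eq_char[OF dens_f])
    ultimately show ?thesis
      using that by (simp add: char_X norm_mult mult_left_le_one_le)
  qed
  \<comment> \<open>A convergent sequence is bounded; replacing \<open>\<sigma> n\<close> by
    \<open>S\<close> makes the moment bound \<open>m\<close> independent of n.\<close>
  obtain S where S: "\<And>n. \<bar>\<sigma> n\<bar> \<le> S"
    using convergent_imp_Bseq[OF convergentI[OF \<sigma>_lim]] by (auto simp: Bseq_def)
  define m where "m = 1 + (\<integral>y. f y * y\<^sup>2 \<partial>lborel) + S * (1 + (\<integral>z. k z * z\<^sup>2 \<partial>lborel)) + \<bar>x\<bar>"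
  have X_int: "integrable (M n) (X n 1)" and X_mom: "(\<integral>\<omega>. \<bar>X n 1 \<omega> - x\<bar> \<partial>M n) \<le> m" if n: "n \<ge> 1" for n
  proof -
    have 1: "1 \<in> {1..n}" using n by simp
    note mom = deconv_sample_abs_moment[OF sample dens_f dens_k 1 Y_sq[OF 1] Z_sq[OF 1], of "\<sigma> n"]
    show "integrable (M n) (X n 1)" using mom(1) by (simp add: X_def[abs_def])
    have "(\<integral>z. k z * z\<^sup>2 \<partial>lborel) \<ge> 0"
      using dens_k by (intro integral_nonneg_AE) (auto simp: prob_density_def)
    then have "\<bar>\<sigma> n\<bar> * (1 + (\<integral>z. k z * z\<^sup>2 \<partial>lborel)) \<le> S * (1 + (\<integral>z. k z * z\<^sup>2 \<partial>lborel))"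
      by (intro mult_right_mono S) auto
    then show "(\<integral>\<omega>. \<bar>X n 1 \<omega> - x\<bar> \<partial>M n) \<le> m"
      using mom(2)[of x] by (simp add: X_def m_def)
  qed

  \<comment> \<open>Mean and second moment of a normalised summand\<close>
  define a where "a n = (\<integral>\<omega>. g n (X n 1 \<omega>) \<partial>M n)" for n
  define q where "q n = (\<integral>\<omega>. (g n (X n 1 \<omega>))\<^sup>2 \<partial>M n)" for n
  have moments: "\<forall>\<^sub>F n in sequentially.
      \<bar>a n\<bar> \<le> \<bar>\<epsilon> n\<bar> + K * \<delta> n * m + \<bar>b\<bar> * norm (dens_cf k (1 / \<rho> n)) \<and>
      \<bar>q n - b\<^sup>2 / 2\<bar> \<le> (K + \<bar>b\<bar>) * (\<bar>\<epsilon> n\<bar> + K * \<delta> n * m) + b\<^sup>2 / 2 * norm (dens_cf k (2 / \<rho> n))"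
    using g_bounds eventually_ge_at_top[of 1]
  proof eventually_elim
    case (elim n)
    interpret prob_space "M n" by (rule M)
    have \<delta>: "0 \<le> K * \<delta> n" using K h_pos[of n] by (simp add: \<delta>_def)
    have "\<bar>a n\<bar> \<le> \<bar>\<epsilon> n\<bar> + K * \<delta> n * m + \<bar>b\<bar> * norm (char (distr (M n) borel (X n 1)) (1 / h n))"
      unfolding a_def using elim \<delta>
      by (intro moments_of_approx_cos(1)[OF X_int X_mom]) auto
    also have "\<dots> \<le> \<bar>\<epsilon> n\<bar> + K * \<delta> n * m + \<bar>b\<bar> * norm (dens_cf k (1 / \<rho> n))"
      by (intro add_left_mono mult_left_mono char_le elim) auto
    finally have 1: "\<bar>a n\<bar> \<le> \<bar>\<epsilon> n\<bar> + K * \<delta> n * m + \<bar>b\<bar> * norm (dens_cf k (1 / \<rho> n))" .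
    have "\<bar>q n - b\<^sup>2 / 2\<bar> \<le> (K + \<bar>b\<bar>) * (\<bar>\<epsilon> n\<bar> + K * \<delta> n * m) + b\<^sup>2 / 2 * norm (char (distr (M n) borel (X n 1)) (2 * (1 / h n)))"
      unfolding q_def using elim \<delta>
      by (intro moments_of_approx_cos(2)[OF X_int X_mom]) auto
    also have "\<dots> \<le> (K + \<bar>b\<bar>) * (\<bar>\<epsilon> n\<bar> + K * \<delta> n * m) + b\<^sup>2 / 2 * norm (dens_cf k (2 / \<rho> n))"
      using char_le[OF elim(2), of 2] by (intro add_left_mono mult_left_mono) auto
    finally show ?case using 1 by blast
  qed
  have err: "(\<lambda>n. \<bar>\<epsilon> n\<bar> + K * \<delta> n * m) \<longlonglongrightarrow> 0"
    using tendsto_add[OF tendsto_rabs_zero[OF \<epsilon>] tendsto_mult_left_zero[OF tendsto_mult_right_zero[OF \<delta>]], of K m] by simp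
  have a_lim: "a \<longlonglongrightarrow> 0"
  proof (rule Lim_null_comparison)
    show "\<forall>\<^sub>F n in sequentially. norm (a n) \<le> \<bar>\<epsilon> n\<bar> + K * \<delta> n * m + \<bar>b\<bar> * norm (dens_cf k (1 / \<rho> n))"
      using moments by eventually_elim simp
    show "(\<lambda>n. \<bar>\<epsilon> n\<bar> + K * \<delta> n * m + \<bar>b\<bar> * norm (dens_cf k (1 / \<rho> n))) \<longlonglongrightarrow> 0"
      using tendsto_add[OF err tendsto_mult_right_zero[OF char_lim[of 1]], of "\<bar>b\<bar>"] by simp
  qed
  have q_lim: "q \<longlonglongrightarrow> b\<^sup>2 / 2"
  proof (rule Lim_null[THEN iffD2], rule Lim_null_comparison)
    show "\<forall>\<^sub>F n in sequentially. norm (q n - b\<^sup>2 / 2)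
        \<le> (K + \<bar>b\<bar>) * (\<bar>\<epsilon> n\<bar> + K * \<delta> n * m) + b\<^sup>2 / 2 * norm (dens_cf k (2 / \<rho> n))"
      using moments by eventually_elim simp
    show "(\<lambda>n. (K + \<bar>b\<bar>) * (\<bar>\<epsilon> n\<bar> + K * \<delta> n * m) + b\<^sup>2 / 2 * norm (dens_cf k (2 / \<rho> n))) \<longlonglongrightarrow> 0"
      using tendsto_add[OF tendsto_mult_right_zero[OF err] tendsto_mult_right_zero[OF char_lim[of 2]], of "K + \<bar>b\<bar>" "b\<^sup>2 / 2"] by simp
  qed

  \<comment> \<open>The centred array and its central limit theorem\<close>
  define \<xi> where "\<xi> n j \<omega> = g n (X n j \<omega>) - a n" for n j \<omega>
  \<comment> \<open>Row 0 is empty and nothing is known about \<open>X 0 1\<close>, not even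
    measurability. A point mass serves as its law, since the limit theorem wants a distribution for
    every n.\<close>
  define P where "P n = (if n = 0 then return borel 0 else distr (M n) borel (\<xi> n 1))" for n
  have \<xi>_meas: "\<xi> n j \<in> borel_measurable (M n)" if "j \<in> {1..n}" for n j
    using X_meas[OF that] unfolding \<xi>_def[abs_def] by measurable
  have gX_int: "integrable (M n) (\<lambda>\<omega>. g n (X n j \<omega>))" "integrable (M n) (\<lambda>\<omega>. (g n (X n j \<omega>))\<^sup>2)" if j: "j \<in> {1..n}" for n j
  proof -
    interpret prob_space "M n" by (rule M)
    note [measurable] = X_meas[OF j]
    obtain B where B: "\<And>y. \<bar>g n y\<bar> \<le> B" using g_bdd by blast
    then have "(g n y)\<^sup>2 \<le> B\<^sup>2" for y by (metis abs_ge_zero power2_abs power_mono)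
    with B show "integrable (M n) (\<lambda>\<omega>. g n (X n j \<omega>))" "integrable (M n) (\<lambda>\<omega>. (g n (X n j \<omega>))\<^sup>2)"
      by (auto intro: integrable_const_bound[of _ B] integrable_const_bound[of _ "B\<^sup>2"])
  qed
  have law_transfer: "distr (M n) borel (\<lambda>\<omega>. G (X n j \<omega>)) = distr (M n) borel (\<lambda>\<omega>. G (X n 1 \<omega>))"
    if j: "j \<in> {1..n}" and [measurable]: "G \<in> borel_measurable borel" for n j and G :: "real \<Rightarrow> real"
  proof -
    have "1 \<in> {1..n}" using j by simp
    note [measurable] = X_meas[OF j] X_meas[OF this]
    have "distr (M n) borel (\<lambda>\<omega>. G (X n j \<omega>)) = distr (distr (M n) borel (X n j)) borel G"
      by (simp add: distr_distr comp_def)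
    also have "\<dots> = distr (M n) borel (\<lambda>\<omega>. G (X n 1 \<omega>))"
      unfolding X_law[OF j] by (simp add: distr_distr comp_def del: One_nat_def)
    finally show ?thesis .
  qed
  have a_eq: "(\<integral>\<omega>. g n (X n j \<omega>) \<partial>M n) = a n" if j: "j \<in> {1..n}" for n j
  proof -
    have "1 \<in> {1..n}" using j by simp
    note [measurable] = X_meas[OF j] X_meas[OF this]
    have "(\<integral>\<omega>. g n (X n j \<omega>) \<partial>M n) = (\<integral>y. y \<partial>distr (M n) borel (\<lambda>\<omega>. g n (X n j \<omega>)))"
      by (subst integral_distr) auto
    also have "\<dots> = a n"
      unfolding law_transfer[OF j \<open>g n \<in> borel_measurable borel\<close>] a_def by (subst integral_distr) (auto simp del: One_nat_def)
    finally show ?thesis .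
  qed
  have "weak_conv_m (\<lambda>n. distr (M n) borel (\<lambda>\<omega>. (\<Sum>j = 1..n. \<xi> n j \<omega>) / sqrt (real n))) (normal_law 0 (b\<^sup>2 / 2))"
  \<comment> \<open>Eventually both \<open>g n\<close> and its mean \<open>a n\<close> are bounded
    by \<open>K\<close>, so the centred variables are bounded by twice that.\<close>
  proof (rule triangular_bounded_clt[where P = P and B = "2 * K"])
    fix n
    interpret prob_space "M n" by (rule M)
    show "prob_space (M n)" by (rule M)
    show "indep_vars (\<lambda>_. borel) (\<xi> n) {1..n}"
      unfolding \<xi>_def[abs_def] X_def[abs_def]
      by (rule indep_vars_compose2[OF deconv_sample_indep_sum[OF sample]]) measurable
    show "real_distribution (P n)"
    proof (cases "n = 0")
      case True
      then show ?thesis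
        by (auto simp: P_def real_distribution_def real_distribution_axioms_def intro: prob_space_return)
    qed (auto simp: P_def intro!: real_distribution_distr \<xi>_meas)
    show "distr (M n) borel (\<xi> n j) = P n" if "j \<in> {1..n}" for j
      using law_transfer[OF that, of "\<lambda>y. g n y - a n"] that by (simp add: P_def \<xi>_def[abs_def])
  next
    show "\<forall>\<^sub>F n in sequentially. AE y in P n. \<bar>y\<bar> \<le> 2 * K"
      using g_bounds eventually_ge_at_top[of 1]
    proof eventually_elim
      case (elim n)
      interpret prob_space "M n" by (rule M)
      have 1: "1 \<in> {1..n}" using elim by simp
      note [measurable] = \<xi>_meas[OF 1]
      have "\<bar>a n\<bar> \<le> (\<integral>\<omega>. \<bar>g n (X n 1 \<omega>)\<bar> \<partial>M n)"
        unfolding a_def by (rule integral_abs_bound)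
      also have "\<dots> \<le> K"
        using elim gX_int(1)[OF 1] by (intro integral_le_const) auto
      finally have "\<bar>a n\<bar> \<le> K" .
      then have "\<bar>\<xi> n 1 \<omega>\<bar> \<le> 2 * K" for \<omega>
        using elim(1)[THEN spec, of "X n 1 \<omega>"] unfolding \<xi>_def by linarith
      moreover have "P n = distr (M n) borel (\<xi> n 1)" using elim(2) by (simp add: P_def)
      ultimately show ?case
        by (simp only:) (subst AE_distr_iff[OF \<xi>_meas[OF 1]], auto)
    qed
    show "\<forall>\<^sub>F n in sequentially. (\<integral>y. y \<partial>P n) = 0"
      using eventually_ge_at_top[of 1]
    proof eventually_elim
      case (elim n)
      interpret prob_space "M n" by (rule M)
      have 1: "1 \<in> {1..n}" using elim by simp
      note [measurable] = \<xi>_meas[OF 1]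
      show ?case
        using elim gX_int(1)[OF 1] by (simp add: P_def integral_distr \<xi>_def prob_space a_def del: One_nat_def)
    qed
    have "(\<lambda>n. q n - (a n)\<^sup>2) \<longlonglongrightarrow> b\<^sup>2 / 2 - 0\<^sup>2"
      by (intro tendsto_intros q_lim a_lim)
    then show "(\<lambda>n. \<integral>y. y\<^sup>2 \<partial>P n) \<longlonglongrightarrow> b\<^sup>2 / 2"
    proof (rule Lim_transform_eventually[THEN tendsto_eq_rhs])
      show "\<forall>\<^sub>F n in sequentially. q n - (a n)\<^sup>2 = (\<integral>y. y\<^sup>2 \<partial>P n)"
        using eventually_ge_at_top[of 1]
      proof eventually_elim
        case (elim n)
        interpret prob_space "M n" by (rule M)
        have 1: "1 \<in> {1..n}" using elim by simp
        note [measurable] = \<xi>_meas[OF 1]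
        have "(\<integral>y. y\<^sup>2 \<partial>P n) = variance (\<lambda>\<omega>. g n (X n 1 \<omega>))"
          using elim by (simp add: P_def integral_distr \<xi>_def a_def del: One_nat_def)
        also have "\<dots> = q n - (a n)\<^sup>2"
          unfolding q_def a_def by (rule variance_eq[OF gX_int[OF 1]])
        finally show ?case by simp
      qed
    qed simp
  qed
  \<comment> \<open>This is an exact identity at every n. At \<open>n = 0\<close> both sides are 0,
    by the factor sqrt 0 and by the empty sum.\<close>
  moreover have "sqrt (real n) * \<sigma> n / (\<rho> n powr (lam * (1 + \<alpha>) + lam0 - 1) * \<zeta> (\<rho> n))
         * (T n \<omega> - prob_space.expectation (M n) (T n)) = (\<Sum>j = 1..n. \<xi> n j \<omega>) / sqrt (real n)" for n \<omega>
  proof -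
    interpret prob_space "M n" by (rule M)
    define c where "c = sqrt (real n) * \<sigma> n / (\<rho> n powr (lam * (1 + \<alpha>) + lam0 - 1) * \<zeta> (\<rho> n))"
    \<comment> \<open>The exponent of \<rho> in the statement is smaller by one than in
      \<open>N\<close>; the factor \<rho> that this releases joins \<sigma> to give \<sigma> \<rho>
      = h, which cancels the bandwidth of the estimator.\<close>
    have c: "c * (1 / (real n * h n)) = 1 / sqrt (real n) / N n"
    proof -
      have "\<rho> n powr (lam * (1 + \<alpha>) + lam0 - 1) = \<rho> n powr (lam * (1 + \<alpha>) + lam0) / \<rho> n"
        using \<rho>_pos[of n] by (simp add: powr_diff)
      then have "c = sqrt (real n) * h n / N n"
        using \<rho>_pos[of n] \<sigma>_pos[of n] by (simp add: c_def N_def) (simp add: \<rho>_def)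
      then have "c * (1 / (real n * h n)) = sqrt (real n) / real n / N n"
        using h_pos[of n] by simp
      then show ?thesis by (simp add: sqrt_divide_self_eq inverse_eq_divide)
    qed
    have cT: "c * T n \<omega> = (\<Sum>j = 1..n. g n (X n j \<omega>)) / sqrt (real n)" for \<omega>
    proof -
      have "T n \<omega> = 1 / (real n * h n) * (\<Sum>j = 1..n. sd.kde_weight (\<rho> n) ((X n j \<omega> - x) / h n))"
        unfolding T_def X_def \<rho>_def by (subst sd.deconv_kde_eq[OF h_pos \<sigma>_pos]) simp
      then have "c * T n \<omega> = 1 / sqrt (real n) / N n * (\<Sum>j = 1..n. sd.kde_weight (\<rho> n) ((X n j \<omega> - x) / h n))"
        unfolding c[symmetric] by simp
      then show ?thesis by (simp add: g_def sum_divide_distrib mult_ac)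
    qed
    have "c * expectation (T n) = expectation (\<lambda>\<omega>. c * T n \<omega>)" by simp
    also have "\<dots> = (\<Sum>j = 1..n. a n) / sqrt (real n)"
      unfolding cT by (subst integral_divide_zero, subst Bochner_Integration.integral_sum)
        (auto simp: gX_int(1) a_eq)
    finally have "c * (T n \<omega> - expectation (T n)) = (\<Sum>j = 1..n. g n (X n j \<omega>)) / sqrt (real n) - (\<Sum>j = 1..n. a n) / sqrt (real n)"
      by (simp only: right_diff_distrib cT)
    then show ?thesis
      by (simp add: c_def \<xi>_def sum_subtractf diff_divide_distrib)
  qed
  \<comment> \<open>The power of \<mu> / lam is the scaling of the Gamma integral in
    \<open>sd.edge_const\<close>, squared; 2 pi^2 combines the pi^2 of b^2 with the mean 1/2 of the
    squared cosine.\<close>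
  moreover have "b\<^sup>2 / 2 = A\<^sup>2 / (2 * pi\<^sup>2 * C\<^sup>2) * (\<mu> / lam) powr (2 + 2 * \<alpha>) * (Gamma (\<alpha> + 1))\<^sup>2"
  proof -
    have "(\<mu> / lam) powr (2 + 2 * \<alpha>) = ((\<mu> / lam) powr (\<alpha> + 1))\<^sup>2"
      using lam \<mu> by (simp add: powr_power algebra_simps)
    also have "(\<mu> / lam) powr (\<alpha> + 1) = 1 / (lam / \<mu>) powr (\<alpha> + 1)"
      using lam \<mu> by (simp add: powr_divide)
    finally show ?thesis
      by (simp add: b_def sd.edge_const_def power_divide power_mult_distrib)
  qed
  ultimately show ?thesis by simp
qed

end
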